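(* Let $Q\subset\mathbb{R}^3$ be open, $I\subset\mathbb{R}$ an open interval, $\varepsilon>0$, and let $\phi:\mathbb{R}^3\times I\to\mathbb{R}$ and $u:\mathbb{R}^3\times I\to\mathbb{R}^3$ be smooth with $\phi_t+u\cdot\nabla\phi=0$. Assume there is a compact set $K\subset Q$ such that $\{x\in Q:|\phi(x,t)|\le\varepsilon\}\subset K$ for all $t\in I$, and that $|\nabla\phi(x,t)|>0$ whenever $x\in Q$, $|\phi(x,t)|\le\varepsilon$. Let $\zeta:\mathbb{R}\to[0,\infty)$ be a $C^1$ function supported in $[-1,1]$ with $\int_{\mathbb{R}}\zeta=1$. Let $n=\nabla\phi/|\nabla\phi|$, $H=\operatorname{div}(n)$, $G=\operatorname{Tr}(\operatorname{Cof}([\nabla n]))$, let $A:\mathbb{R}\to\mathbb{R}$ be smooth, and set $$J^H_\varepsilon(\phi)(t)=\int_Q A(H)\,|\nabla\phi|\,\frac1\varepsilon\zeta\Big(\frac{\phi}{\varepsilon}\Big)\,dx .$$ Then for every $t\in I$ $$\frac{d}{dt}J^H_\varepsilon(\phi)(t)=\int_Q\Big(A(H)H-\Delta_{\partial\Omega}\big(A'(H)\big)-A'(H)(H^2-2G)\Big)\,u\cdot n\,|\nabla\phi|\,\frac1\varepsilon\zeta\Big(\frac{\phi}{\varepsilon}\Big)\,dx .$$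
   Context: $\nabla$, $\operatorname{div}$ are taken with respect to the space variable $x$. The integrands are understood to be $0$ where $|\phi|>\varepsilon$. For a vector field $v$, $[\nabla v]_{ij}=\partial_jv_i$. For a $3\times3$ matrix $M$, $\operatorname{Tr}(\operatorname{Cof}(M))=\frac12(\operatorname{Tr}(M)^2-\operatorname{Tr}(M^2))$. Tangential operators (defined with the field $n$ wherever $n$ is defined): $\nabla_{\partial\Omega}g=\nabla g-(\nabla g\cdot n)n$, $\operatorname{div}_{\partial\Omega}(v)=\operatorname{div}(v)-([\nabla v]n)\cdot n$, $\Delta_{\partial\Omega}g=\operatorname{div}_{\partial\Omega}(\nabla_{\partial\Omega}g)$. *)

theory Defs
  imports "HOL-Analysis.Analysis"
begin

text \<open>On an open subset of a finite-dimensional space, the iterated condition below is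
  the usual notion of class \<open>C\<^sup>k\<close>: all iterated directional derivatives up to order \<open>k\<close>
  exist and are continuous.\<close>

primrec Ck_on ::
    "nat \<Rightarrow> ('a::euclidean_space \<Rightarrow> 'b::real_normed_vector) \<Rightarrow> 'a set \<Rightarrow> bool" where
  "Ck_on 0 f S \<longleftrightarrow> continuous_on S f"
| "Ck_on (Suc k) f S \<longleftrightarrow>
     (\<forall>x\<in>S. f differentiable (at x)) \<and>
     (\<forall>v. Ck_on k (\<lambda>x. frechet_derivative f (at x) v) S)"

definition smooth_on ::
    "('a::euclidean_space \<Rightarrow> 'b::real_normed_vector) \<Rightarrow> 'a set \<Rightarrow> bool" where
  "smooth_on f S \<longleftrightarrow> (\<forall>k. Ck_on k f S)"

definition grad :: "(real^'n \<Rightarrow> real) \<Rightarrow> real^'n \<Rightarrow> real^'n" where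
  "grad f x = (\<chi> i. frechet_derivative f (at x) (axis i 1))"

definition divg :: "(real^'n \<Rightarrow> real^'n) \<Rightarrow> real^'n \<Rightarrow> real" where
  "divg v x = trace (jacobian v (at x))"

text \<open>The \<open>(i,j)\<close> entry is the determinant of \<open>M\<close> with its \<open>i\<close>-th row replaced by the
  \<open>j\<close>-th unit row vector, i.e. the signed \<open>(i,j)\<close> minor.\<close>

definition Cof :: "'a::comm_ring_1^'n^'n \<Rightarrow> 'a^'n^'n" where
  "Cof M = (\<chi> i j. det (\<chi> k. if k = i then axis j 1 else M $ k))"

lemma trace_Cof_3:
  fixes M :: "real^3^3"
  shows "trace (Cof M) = ((trace M)\<^sup>2 - trace (M ** M)) / 2"
  by (simp add: Cof_def trace_def det_3 sum_3 axis_def matrix_matrix_mult_def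
      power2_eq_square field_simps)

definition tgrad :: "(real^'n \<Rightarrow> real^'n) \<Rightarrow> (real^'n \<Rightarrow> real) \<Rightarrow> real^'n \<Rightarrow> real^'n" where
  "tgrad n g x = grad g x - (grad g x \<bullet> n x) *\<^sub>R n x"

definition tdivg :: "(real^'n \<Rightarrow> real^'n) \<Rightarrow> (real^'n \<Rightarrow> real^'n) \<Rightarrow> real^'n \<Rightarrow> real" where
  "tdivg n v x = divg v x - (jacobian v (at x) *v n x) \<bullet> n x"

definition tlaplace :: "(real^'n \<Rightarrow> real^'n) \<Rightarrow> (real^'n \<Rightarrow> real) \<Rightarrow> real^'n \<Rightarrow> real" where
  "tlaplace n g = tdivg n (tgrad n g)"

text \<open>In the following definitions \<open>f\<close> is a level-set function at a frozen time. Where its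
  gradient vanishes, \<open>normal_field f\<close> takes the value \<open>0\<close>.\<close>

definition normal_field :: "(real^'n \<Rightarrow> real) \<Rightarrow> real^'n \<Rightarrow> real^'n" where
  "normal_field f x = grad f x /\<^sub>R norm (grad f x)"

definition mean_curv :: "(real^'n \<Rightarrow> real) \<Rightarrow> real^'n \<Rightarrow> real" where
  "mean_curv f = divg (normal_field f)"

definition gauss_curv :: "(real^3 \<Rightarrow> real) \<Rightarrow> real^3 \<Rightarrow> real" where
  "gauss_curv f x = trace (Cof (jacobian (normal_field f) (at x)))"

text \<open>Integral over \<open>Q\<close> of \<open>F |\<nabla>f| (1/\<epsilon>) \<zeta>(f/\<epsilon>)\<close>, the integrand being \<open>0\<close> where
  \<open>|f| > \<epsilon>\<close>.\<close>

definition smeared_integral ::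
    "(real^3) set \<Rightarrow> real \<Rightarrow> (real \<Rightarrow> real) \<Rightarrow> (real^3 \<Rightarrow> real) \<Rightarrow> (real^3 \<Rightarrow> real) \<Rightarrow> real" where
  "smeared_integral Q \<epsilon> \<zeta> f F =
     (LINT x:Q|lborel.
        (if \<bar>f x\<bar> \<le> \<epsilon> then F x * norm (grad f x) * (1 / \<epsilon>) * \<zeta> (f x / \<epsilon>) else 0))"

definition JH ::
    "(real^3) set \<Rightarrow> real \<Rightarrow> (real \<Rightarrow> real) \<Rightarrow> (real \<Rightarrow> real) \<Rightarrow> ((real^3) \<times> real \<Rightarrow> real)
      \<Rightarrow> real \<Rightarrow> real" where
  "JH Q \<epsilon> \<zeta> A \<phi> t =
     smeared_integral Q \<epsilon> \<zeta> (\<lambda>x. \<phi> (x, t)) (\<lambda>x. A (mean_curv (\<lambda>y. \<phi> (y, t)) x))"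

end

theory Submission
  imports Defs
begin

text \<open>Write \<open>m = |\<nabla>\<phi>|\<close>, \<open>\<psi> = \<phi>\<^sub>t = - (u \<bullet> n) m\<close>, \<open>a = A'(H)\<close>, \<open>Z = \<zeta>(\<phi>/\<epsilon>)/\<epsilon>\<close>, \<open>\<kappa> = [\<nabla>n]n\<close>.
  Symmetry of second derivatives and \<open>|n| = 1\<close> give \<open>m\<^sub>t = n \<bullet> \<nabla>\<psi>\<close>, \<open>m \<kappa> = \<nabla>m - (\<nabla>m \<bullet> n) n\<close>
  and \<open>div \<kappa> = Tr([\<nabla>n][\<nabla>n]) + n \<bullet> \<nabla>H\<close>. With the flux
  \<open>S = A(H) \<psi> n + a m n\<^sub>t - \<psi> (\<nabla>a - (\<nabla>a \<bullet> n) n + a \<kappa>)\<close> the time derivative of \<open>A(H) m Z\<close> equals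
  the claimed integrand plus \<open>div (Z S)\<close>: only the first term of \<open>S\<close> is not tangential, so \<open>\<nabla>Z\<close>,
  which is normal, sees nothing else. As \<open>Z S\<close> is \<open>C\<^sup>1\<close> with compact support in \<open>Q\<close>, its divergence
  integrates to zero, and differentiation under the integral sign gives the result.\<close>

subsection \<open>Calculus of $C^k$ functions\<close>

text \<open>The point comes last, so that \<open>dderiv v f\<close> is again a function and the
  recursion of \<open>Ck_on\<close> applies to it. Its value is informative only at points of
  differentiability.\<close>

abbreviation dderiv :: "'a::euclidean_space \<Rightarrow> ('a \<Rightarrow> 'b::real_normed_vector) \<Rightarrow> 'a \<Rightarrow> 'b" where
  "dderiv v f x \<equiv> frechet_derivative f (at x) v"

lemma dderiv_eqI: "(f has_derivative f') (at x) \<Longrightarrow> dderiv v f x = f' v"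
  using frechet_derivative_at by metis

lemma has_derivative_dderiv:
  "f differentiable (at x) \<Longrightarrow> (f has_derivative (\<lambda>v. dderiv v f x)) (at x)"
  using frechet_derivative_works by blast

text \<open>Both functions have the same derivatives at \<open>x\<close>, so the choice behind
  \<open>frechet_derivative\<close> picks the same map, including the arbitrary one at a point of
  non-differentiability.\<close>

lemma dderiv_cong:
  fixes f g :: "'a::euclidean_space \<Rightarrow> 'b::real_normed_vector"
  assumes "open S" "x \<in> S" "\<And>y. y \<in> S \<Longrightarrow> f y = g y"
  shows "dderiv v f x = dderiv v g x"
proof -
  have "(f has_derivative D) (at x) \<longleftrightarrow> (g has_derivative D) (at x)" for D
    using has_derivative_transform_within_open[of f D x UNIV S g]
      has_derivative_transform_within_open[of g D x UNIV S f] assms by auto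
  then show ?thesis by (simp add: frechet_derivative_def)
qed

lemma differentiable_cong_open:
  fixes f g :: "'a::euclidean_space \<Rightarrow> 'b::real_normed_vector"
  assumes "open S" "x \<in> S" "\<And>y. y \<in> S \<Longrightarrow> f y = g y" "f differentiable (at x)"
  shows "g differentiable (at x)"
  using assms has_derivative_transform_within_open[of f _ x UNIV S g]
  unfolding differentiable_def by auto

lemma Ck_on_cong:
  assumes "open S" "\<And>y. y \<in> S \<Longrightarrow> f y = g y" "Ck_on k f S"
  shows "Ck_on k g S"
  using assms(2,3)
proof (induction k arbitrary: f g)
  case 0
  then show ?case by (simp cong: continuous_on_cong)
next
  case (Suc k)
  have "Ck_on k (dderiv v g) S" for v
  proof (rule Suc.IH[of "dderiv v f"])
    show "dderiv v f y = dderiv v g y" if "y \<in> S" for y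
      by (rule dderiv_cong[OF assms(1) that Suc.prems(1)])
  qed (use Suc.prems in auto)
  moreover have "g differentiable (at x)" if "x \<in> S" for x
    using differentiable_cong_open[OF assms(1) that] Suc.prems that by auto
  ultimately show ?case by simp
qed

lemma Ck_on_SucD: "Ck_on (Suc k) f S \<Longrightarrow> Ck_on k f S"
proof (induction k arbitrary: f)
  case 0
  then show ?case
    by (auto simp: continuous_on_eq_continuous_within
        intro: differentiable_imp_continuous_within differentiable_at_withinI)
next
  case (Suc k)
  then show ?case by (metis Ck_on.simps(2))
qed

lemma Ck_on_imp_continuous_on: "Ck_on k f S \<Longrightarrow> continuous_on S f"
  by (induction k) (use Ck_on_SucD in \<open>auto simp del: Ck_on.simps(2)\<close>)

lemma Ck_on_subset: "Ck_on k f S \<Longrightarrow> T \<subseteq> S \<Longrightarrow> Ck_on k f T"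
  by (induction k arbitrary: f) (auto intro: continuous_on_subset)

lemma Ck_on_Un: "open S \<Longrightarrow> open T \<Longrightarrow> Ck_on k f S \<Longrightarrow> Ck_on k f T \<Longrightarrow> Ck_on k f (S \<union> T)"
  by (induction k arbitrary: f) (auto intro: continuous_on_open_Un)

lemma Ck_on_const [simp]: "Ck_on k (\<lambda>x. c) S"
  by (induction k arbitrary: c) auto

lemma Ck_on_bounded_linear:
  assumes "bounded_linear f"
  shows "Ck_on k f S"
proof (cases k)
  case 0
  then show ?thesis by (simp add: assms linear_continuous_on)
next
  case (Suc j)
  have "dderiv v f = (\<lambda>x. f v)" for v
    by (rule ext, rule dderiv_eqI, rule bounded_linear_imp_has_derivative[OF assms])
  then show ?thesis
    using Suc assms bounded_linear_imp_differentiable by auto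
qed

lemma dderiv_add:
  "f differentiable (at x) \<Longrightarrow> g differentiable (at x) \<Longrightarrow>
    dderiv v (\<lambda>x. f x + g x) x = dderiv v f x + dderiv v g x"
  by (rule dderiv_eqI) (auto intro!: has_derivative_add has_derivative_dderiv)

lemma dderiv_diff:
  "f differentiable (at x) \<Longrightarrow> g differentiable (at x) \<Longrightarrow>
    dderiv v (\<lambda>x. f x - g x) x = dderiv v f x - dderiv v g x"
  by (rule dderiv_eqI) (auto intro!: has_derivative_diff has_derivative_dderiv)

lemma dderiv_mult:
  fixes f g :: "'a::euclidean_space \<Rightarrow> real"
  assumes "f differentiable (at x)" "g differentiable (at x)"
  shows "dderiv v (\<lambda>x. f x * g x) x = dderiv v f x * g x + f x * dderiv v g x"
  using dderiv_eqI[OF has_derivative_mult[OF assms[THEN has_derivative_dderiv]]]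
  by simp

lemma dderiv_sum:
  "(\<And>i. i \<in> F \<Longrightarrow> f i differentiable (at x)) \<Longrightarrow>
    dderiv v (\<lambda>x. \<Sum>i\<in>F. f i x) x = (\<Sum>i\<in>F. dderiv v (f i) x)"
  by (rule dderiv_eqI) (auto intro!: has_derivative_sum has_derivative_dderiv)

lemma dderiv_compose:
  fixes f :: "'a::euclidean_space \<Rightarrow> real" and g :: "real \<Rightarrow> real"
  assumes "f differentiable (at x)" "g differentiable (at (f x))"
  shows "dderiv v (\<lambda>x. g (f x)) x = deriv g (f x) * dderiv v f x"
proof -
  have "(g has_real_derivative deriv g (f x)) (at (f x))"
    using assms(2) by (simp add: DERIV_deriv_iff_real_differentiable)
  then have "(g has_derivative (\<lambda>h. deriv g (f x) * h)) (at (f x))"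
    by (simp add: has_field_derivative_def)
  from has_derivative_compose[OF has_derivative_dderiv[OF assms(1)] this] show ?thesis
    by (rule dderiv_eqI)
qed

lemma Ck_on_add:
  assumes "open S" "Ck_on k f S" "Ck_on k g S"
  shows "Ck_on k (\<lambda>x. f x + g x) S"
  using assms(2,3)
proof (induction k arbitrary: f g)
  case 0
  then show ?case by (simp add: continuous_on_add)
next
  case (Suc k)
  have "Ck_on k (dderiv v (\<lambda>x. f x + g x)) S" for v
    by (rule Ck_on_cong[OF assms(1) _ Suc.IH[of "dderiv v f" "dderiv v g"]])
      (use Suc.prems in \<open>auto simp: dderiv_add\<close>)
  then show ?case using Suc.prems by auto
qed

lemma Ck_on_mult:
  fixes f g :: "'a::euclidean_space \<Rightarrow> real"
  assumes "open S" "Ck_on k f S" "Ck_on k g S"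
  shows "Ck_on k (\<lambda>x. f x * g x) S"
  using assms(2,3)
proof (induction k arbitrary: f g)
  case 0
  then show ?case by (simp add: continuous_on_mult)
next
  case (Suc k)
  have "Ck_on k (\<lambda>x. dderiv v f x * g x + f x * dderiv v g x) S" for v
    using Suc.prems Ck_on_SucD by (intro Ck_on_add[OF assms(1)] Suc.IH) auto
  then have "Ck_on k (dderiv v (\<lambda>x. f x * g x)) S" for v
    by (rule Ck_on_cong[OF assms(1), rotated]) (use Suc.prems in \<open>auto simp: dderiv_mult\<close>)
  then show ?case using Suc.prems by auto
qed

lemma Ck_on_compose:
  fixes f :: "'a::euclidean_space \<Rightarrow> real" and g :: "real \<Rightarrow> real"
  assumes "open S" "Ck_on k f S" "Ck_on k g T" "f ` S \<subseteq> T"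
  shows "Ck_on k (\<lambda>x. g (f x)) S"
  using assms(2-)
proof (induction k arbitrary: g)
  case 0
  then show ?case by (auto intro: continuous_on_compose2)
next
  case (Suc k)
  \<comment> \<open>The chain rule \<open>dderiv_compose\<close> is stated with
    \<open>deriv\<close>; taking the identity as inner function identifies it with
    \<open>dderiv 1 g\<close>, to which the induction hypothesis applies.\<close>
  have *: "dderiv 1 g s = deriv g s" if "s \<in> T" for s
    using Suc.prems that dderiv_compose[of "\<lambda>x. x" s g 1] by auto
  have "Ck_on k (\<lambda>x. dderiv 1 g (f x)) S"
    by (rule Suc.IH[of "dderiv 1 g"]) (use Suc.prems Ck_on_SucD[of k f] in auto)
  then have "Ck_on k (\<lambda>x. dderiv 1 g (f x) * dderiv v f x) S" for v
    using Suc.prems by (intro Ck_on_mult[OF assms(1)]) auto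
  then have "Ck_on k (dderiv v (\<lambda>x. g (f x))) S" for v
    by (rule Ck_on_cong[OF assms(1), rotated])
      (use Suc.prems in \<open>auto simp: dderiv_compose * image_subset_iff\<close>)
  moreover have "(\<lambda>x. g (f x)) differentiable (at x)" if "x \<in> S" for x
    using Suc.prems that differentiable_chain_at[of f x g] by (auto simp: o_def)
  ultimately show ?case by simp
qed

section \<open>Smooth functions and their closure properties\<close>

lemma
  assumes "smooth_on f S"
  shows smooth_on_imp_differentiable: "x \<in> S \<Longrightarrow> f differentiable (at x)"
    and smooth_on_dderiv: "smooth_on (dderiv v f) S"
proof -
  have *: "Ck_on (Suc k) f S" for k
    using assms by (simp add: smooth_on_def del: Ck_on.simps)
  show "x \<in> S \<Longrightarrow> f differentiable (at x)"
    using *[of 0] by simp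
  show "smooth_on (dderiv v f) S"
    using * by (simp add: smooth_on_def)
qed

lemma smooth_on_subset: "smooth_on f S \<Longrightarrow> T \<subseteq> S \<Longrightarrow> smooth_on f T"
  by (auto simp: smooth_on_def intro: Ck_on_subset)

lemma smooth_on_const: "smooth_on (\<lambda>x. c) S"
  by (simp add: smooth_on_def)

lemma smooth_on_add:
  "open S \<Longrightarrow> smooth_on f S \<Longrightarrow> smooth_on g S \<Longrightarrow> smooth_on (\<lambda>x. f x + g x) S"
  by (simp add: smooth_on_def Ck_on_add)

lemma smooth_on_mult:
  fixes f g :: "'a::euclidean_space \<Rightarrow> real"
  shows "open S \<Longrightarrow> smooth_on f S \<Longrightarrow> smooth_on g S \<Longrightarrow> smooth_on (\<lambda>x. f x * g x) S"
  by (simp add: smooth_on_def Ck_on_mult)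

lemma smooth_on_diff:
  fixes f g :: "'a::euclidean_space \<Rightarrow> real"
  assumes "open S" "smooth_on f S" "smooth_on g S"
  shows "smooth_on (\<lambda>x. f x - g x) S"
  using smooth_on_add[OF assms(1,2) smooth_on_mult[OF assms(1) smooth_on_const[of "-1"] assms(3)]]
  by simp

lemma smooth_on_sum:
  "open S \<Longrightarrow> (\<And>i. i \<in> F \<Longrightarrow> smooth_on (f i) S) \<Longrightarrow> smooth_on (\<lambda>x. \<Sum>i\<in>F. f i x) S"
  by (induction F rule: infinite_finite_induct) (auto intro: smooth_on_const smooth_on_add)

lemma smooth_on_compose:
  fixes f :: "'a::euclidean_space \<Rightarrow> real" and g :: "real \<Rightarrow> real"
  shows "open S \<Longrightarrow> smooth_on f S \<Longrightarrow> smooth_on g T \<Longrightarrow> f ` S \<subseteq> T \<Longrightarrow>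
    smooth_on (\<lambda>x. g (f x)) S"
  using Ck_on_compose[of S _ f g T] by (simp add: smooth_on_def)

text \<open>The derivative of \<open>r = inverse (sqrt x)\<close> is \<open>- r^3 / 2\<close>, a
  polynomial in \<open>r\<close> itself, so the induction closes.\<close>

lemma Ck_on_inverse_sqrt: "Ck_on k (\<lambda>x::real. inverse (sqrt x)) {0<..}"
proof (induction k)
  case 0
  have "continuous_on {0<..} (\<lambda>x::real. inverse (sqrt x))"
    by (intro continuous_on_inverse continuous_on_real_sqrt continuous_on_id) auto
  then show ?case by simp
next
  case (Suc k)
  let ?r = "\<lambda>x::real. inverse (sqrt x)"
  have D: "(?r has_derivative (\<lambda>v. (- v / 2) * (?r x * (?r x * ?r x)))) (at x)"
    if "x \<in> {0<..}" for x
    using that by (auto intro!: derivative_eq_intros simp: field_simps)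
  have "Ck_on k (\<lambda>x. (- v / 2) * (?r x * (?r x * ?r x))) {0<..}" for v
    by (intro Ck_on_mult Suc Ck_on_const) auto
  then have "Ck_on k (dderiv v ?r) {0<..}" for v
    by (rule Ck_on_cong[rotated 2]) (auto simp: dderiv_eqI[OF D])
  moreover have "?r differentiable (at x)" if "x \<in> {0<..}" for x
    using D[OF that] by (auto simp: differentiable_def)
  ultimately show ?case by simp
qed

lemma smooth_on_inverse_sqrt:
  fixes f :: "'a::euclidean_space \<Rightarrow> real"
  assumes "open S" "smooth_on f S" "\<And>x. x \<in> S \<Longrightarrow> f x > 0"
  shows "smooth_on (\<lambda>x. inverse (sqrt (f x))) S"
  using smooth_on_compose[OF assms(1,2), of "\<lambda>x. inverse (sqrt x)" "{0<..}"] assms(3)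
  by (auto simp: smooth_on_def Ck_on_inverse_sqrt)

lemma smooth_on_deriv:
  fixes g :: "real \<Rightarrow> real"
  assumes "open T" "smooth_on g T"
  shows "smooth_on (deriv g) T"
proof -
  have "dderiv 1 g s = deriv g s" if "s \<in> T" for s
    using smooth_on_imp_differentiable[OF assms(2) that] dderiv_compose[of "\<lambda>x. x" s g 1] by auto
  then show ?thesis
    using smooth_on_dderiv[OF assms(2), of 1] Ck_on_cong[OF assms(1), of "dderiv 1 g" "deriv g"]
    unfolding smooth_on_def by blast
qed

section \<open>Symmetry of second derivatives\<close>

lemma MVT_segment:
  fixes f :: "'a::euclidean_space \<Rightarrow> real"
  assumes "h > 0" "\<And>s. 0 \<le> s \<Longrightarrow> s \<le> h \<Longrightarrow> f differentiable (at (x + s *\<^sub>R v))"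
  obtains s where "0 < s" "s < h" "f (x + h *\<^sub>R v) - f x = h * dderiv v f (x + s *\<^sub>R v)"
proof -
  have "((\<lambda>s. f (x + s *\<^sub>R v)) has_real_derivative dderiv v f (x + s *\<^sub>R v)) (at s)"
    if "0 \<le> s" "s \<le> h" for s
  proof -
    have lin: "linear (\<lambda>v. dderiv v f (x + s *\<^sub>R v'))" if "f differentiable (at (x + s *\<^sub>R v'))" for v'
      using linear_frechet_derivative[OF that] .
    have "((\<lambda>s. x + s *\<^sub>R v) has_derivative (\<lambda>r. r *\<^sub>R v)) (at s)"
      by (auto intro!: derivative_eq_intros)
    from has_derivative_compose[OF this has_derivative_dderiv[OF assms(2)[OF that]]]
    show ?thesis
      using linear_cmul[OF lin[OF assms(2)[OF that]]] unfolding has_field_derivative_def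
      by (simp add: mult_commute_abs)
  qed
  from MVT2[of 0 h "\<lambda>s. f (x + s *\<^sub>R v)", OF assms(1) this] that show ?thesis
    by auto
qed

text \<open>Both iterated derivatives are compared with the same second difference quotient.\<close>

lemma second_difference_mean_value:
  fixes f :: "'a::euclidean_space \<Rightarrow> real"
  assumes f: "Ck_on 2 f (ball x r)" and h: "h > 0" "h * (norm v + norm w) < r"
  obtains y where "dist x y \<le> h * (norm v + norm w)"
    "f (x + h *\<^sub>R v + h *\<^sub>R w) - f (x + h *\<^sub>R v) - f (x + h *\<^sub>R w) + f x
      = h * h * dderiv w (dderiv v f) y"
proof -
  have bound: "norm (s *\<^sub>R v + q *\<^sub>R w) \<le> h * (norm v + norm w)"
    if "0 \<le> s" "s \<le> h" "0 \<le> q" "q \<le> h" for s q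
  proof -
    have "norm (s *\<^sub>R v + q *\<^sub>R w) \<le> s * norm v + q * norm w"
      using norm_triangle_ineq[of "s *\<^sub>R v" "q *\<^sub>R w"] that by simp
    also have "\<dots> \<le> h * norm v + h * norm w"
      using that by (intro add_mono mult_right_mono) auto
    finally show ?thesis by (simp add: algebra_simps)
  qed
  have dist_eq: "dist x (x + s *\<^sub>R v + q *\<^sub>R w) = norm (s *\<^sub>R v + q *\<^sub>R w)" for s q
    by (metis add.assoc add_diff_cancel_left' dist_commute dist_norm)
  have inball: "x + s *\<^sub>R v + q *\<^sub>R w \<in> ball x r"
    if "0 \<le> s" "s \<le> h" "0 \<le> q" "q \<le> h" for s q
    unfolding mem_ball dist_eq using bound[OF that] h by linarith
  have d1: "f differentiable (at z)" if "z \<in> ball x r" for z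
    using f that by (simp add: numeral_2_eq_2)
  have d2: "dderiv v f differentiable (at z)" if "z \<in> ball x r" for z
    using f that by (simp add: numeral_2_eq_2)
  let ?g = "\<lambda>z. f (z + h *\<^sub>R w) - f z"
  have sh: "(\<lambda>z. f (z + h *\<^sub>R w)) differentiable (at z)"
    "dderiv v (\<lambda>z. f (z + h *\<^sub>R w)) z = dderiv v f (z + h *\<^sub>R w)"
    if "z + h *\<^sub>R w \<in> ball x r" for z
  proof -
    have "((\<lambda>z. z + h *\<^sub>R w) has_derivative (\<lambda>u. u)) (at z)"
      by (auto intro!: derivative_eq_intros)
    from has_derivative_compose[OF this has_derivative_dderiv[OF d1[OF that]]]
    show "(\<lambda>z. f (z + h *\<^sub>R w)) differentiable (at z)"
      "dderiv v (\<lambda>z. f (z + h *\<^sub>R w)) z = dderiv v f (z + h *\<^sub>R w)"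
      by (auto simp: differentiable_def intro: dderiv_eqI)
  qed
  have ball0: "x + s *\<^sub>R v \<in> ball x r" if "0 \<le> s" "s \<le> h" for s
    using inball[OF that, of 0] h by simp
  \<comment> \<open>The mean value theorem acts first in direction \<open>v\<close> on the increment
    of \<open>f\<close> by \<open>h *\<^sub>R w\<close>, then in direction \<open>w\<close> on
    \<open>dderiv v f\<close>.\<close>
  obtain s where s: "0 < s" "s < h" "?g (x + h *\<^sub>R v) - ?g x = h * dderiv v ?g (x + s *\<^sub>R v)"
  proof (rule MVT_segment[OF h(1), of ?g x v])
    show "?g differentiable (at (x + s *\<^sub>R v))" if "0 \<le> s" "s \<le> h" for s
      using sh(1)[of "x + s *\<^sub>R v"] inball[OF that, of h] d1 ball0[OF that] h
      by (intro differentiable_diff) auto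
  qed
  have gs: "dderiv v ?g (x + s *\<^sub>R v)
      = dderiv v f (x + s *\<^sub>R v + h *\<^sub>R w) - dderiv v f (x + s *\<^sub>R v)"
    using sh[of "x + s *\<^sub>R v"] inball[of s h] d1 ball0[of s] h s
    by (subst dderiv_diff) auto
  obtain q where q: "0 < q" "q < h" "dderiv v f (x + s *\<^sub>R v + h *\<^sub>R w) - dderiv v f (x + s *\<^sub>R v)
     = h * dderiv w (dderiv v f) (x + s *\<^sub>R v + q *\<^sub>R w)"
    by (rule MVT_segment[OF h(1), of "dderiv v f" "x + s *\<^sub>R v" w]) (use inball d2 s in auto)
  show ?thesis
  proof (rule that[of "x + s *\<^sub>R v + q *\<^sub>R w"])
    show "dist x (x + s *\<^sub>R v + q *\<^sub>R w) \<le> h * (norm v + norm w)"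
      unfolding dist_eq using bound[of s q] s q by linarith
    show "f (x + h *\<^sub>R v + h *\<^sub>R w) - f (x + h *\<^sub>R v) - f (x + h *\<^sub>R w) + f x
      = h * h * dderiv w (dderiv v f) (x + s *\<^sub>R v + q *\<^sub>R w)"
      using s(3) gs q(3) by (simp add: algebra_simps)
  qed
qed

text \<open>Taking \<open>v\<close> and \<open>w\<close> in both orders gives points
  \<open>y n\<close> and \<open>z n\<close> tending to \<open>x\<close> at which the two mixed
  derivatives agree; continuity carries this to the limit.\<close>

lemma dderiv_commute:
  fixes f :: "'a::euclidean_space \<Rightarrow> real"
  assumes "open S" "Ck_on 2 f S" "x \<in> S"
  shows "dderiv v (dderiv w f) x = dderiv w (dderiv v f) x"
proof -
  obtain r where r: "r > 0" "ball x r \<subseteq> S"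
    using assms(1,3) open_contains_ball by blast
  have f: "Ck_on 2 f (ball x r)"
    using assms(2) r(2) Ck_on_subset by blast
  \<comment> \<open>The summand 1 makes \<open>c\<close> positive and strictly larger than
    \<open>norm v + norm w\<close>, so every \<open>h n\<close> is positive and the difference
    quotient stays inside the ball.\<close>
  define c where "c = norm v + norm w + 1"
  have c: "c > 0" unfolding c_def by (smt (verit) norm_ge_zero)
  define h where "h n = r / c / real (n + 2)" for n
  have h0: "h n > 0" for n using r c by (simp add: h_def)
  have hr: "h n * (norm v + norm w) < r" for n
  proof -
    have "h n * (norm v + norm w) < h n * c" using h0[of n] by (simp add: c_def)
    also have "\<dots> = r / real (n + 2)" using c by (simp add: h_def)
    also have "\<dots> \<le> r" using r by (simp add: field_simps)
    finally show ?thesis .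
  qed
  have lim: "(\<lambda>n. h n * (norm v + norm w)) \<longlonglongrightarrow> 0"
    unfolding h_def using LIMSEQ_ignore_initial_segment[OF lim_const_over_n[of "r / c"], of 2]
    by (intro tendsto_mult_left_zero) simp
  have "\<exists>y. dist x y \<le> h n * (norm v + norm w) \<and>
      f (x + h n *\<^sub>R v + h n *\<^sub>R w) - f (x + h n *\<^sub>R v) - f (x + h n *\<^sub>R w) + f x
      = h n * h n * dderiv w (dderiv v f) y" for n
    using second_difference_mean_value[OF f h0 hr, of n] by metis
  then obtain y where y: "\<And>n. dist x (y n) \<le> h n * (norm v + norm w)"
    "\<And>n. f (x + h n *\<^sub>R v + h n *\<^sub>R w) - f (x + h n *\<^sub>R v) - f (x + h n *\<^sub>R w) + f x
      = h n * h n * dderiv w (dderiv v f) (y n)"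
    by metis
  have "\<exists>y. dist x y \<le> h n * (norm w + norm v) \<and>
      f (x + h n *\<^sub>R w + h n *\<^sub>R v) - f (x + h n *\<^sub>R w) - f (x + h n *\<^sub>R v) + f x
      = h n * h n * dderiv v (dderiv w f) y" for n
    using second_difference_mean_value[OF f h0, of n w v] hr by (metis add.commute)
  then obtain z where z: "\<And>n. dist x (z n) \<le> h n * (norm w + norm v)"
    "\<And>n. f (x + h n *\<^sub>R w + h n *\<^sub>R v) - f (x + h n *\<^sub>R w) - f (x + h n *\<^sub>R v) + f x
      = h n * h n * dderiv v (dderiv w f) (z n)"
    by metis
  have eq: "dderiv w (dderiv v f) (y n) = dderiv v (dderiv w f) (z n)" for n
  proof -
    have "h n * h n * dderiv w (dderiv v f) (y n) = h n * h n * dderiv v (dderiv w f) (z n)"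
      using y(2)[of n] z(2)[of n] by (simp add: algebra_simps)
    then show ?thesis using h0[of n] by simp
  qed
  have yx: "y \<longlonglongrightarrow> x"
    using Lim_null_comparison[OF _ lim, of "\<lambda>n. y n - x"] y(1)
    by (simp add: dist_norm norm_minus_commute LIM_zero_iff)
  have zx: "z \<longlonglongrightarrow> x"
    using Lim_null_comparison[OF _ lim, of "\<lambda>n. z n - x"] z(1)
    by (simp add: dist_norm norm_minus_commute LIM_zero_iff add.commute)
  have cont: "isCont (dderiv a (dderiv b f)) x" for a b
  proof -
    have "continuous_on S (dderiv a (dderiv b f))"
      using assms(2) by (simp add: numeral_2_eq_2)
    then show ?thesis using assms(1,3) by (simp add: continuous_on_eq_continuous_at)
  qed
  have "(\<lambda>n. dderiv w (dderiv v f) (y n)) \<longlonglongrightarrow> dderiv w (dderiv v f) x"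
    "(\<lambda>n. dderiv v (dderiv w f) (z n)) \<longlonglongrightarrow> dderiv v (dderiv w f) x"
    using cont isCont_tendsto_compose yx zx by blast+
  then show ?thesis
    using eq LIMSEQ_unique by simp
qed

subsection \<open>Integrals depending on a parameter\<close>

lemma Ck_on_1:
  "Ck_on 1 f S \<longleftrightarrow> (\<forall>x\<in>S. f differentiable (at x)) \<and> (\<forall>v. continuous_on S (dderiv v f))"
  by simp

text \<open>The rule \<open>leibniz_rule_field_derivative\<close> is about the gauge integral over a
  box. A continuous function vanishing off the box equals its restriction to it, so both integrals
  agree.\<close>

lemma lborel_integral_eq_integral_cbox:
  fixes g :: "'a::euclidean_space \<Rightarrow> real"
  assumes "continuous_on UNIV g" "\<And>x. x \<notin> cbox a b \<Longrightarrow> g x = 0"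
  shows "integrable lborel g" "integral\<^sup>L lborel g = integral (cbox a b) g"
proof -
  have "integrable lborel (\<lambda>x. indicator (cbox a b) x *\<^sub>R g x)"
    by (rule borel_integrable_compact[OF compact_cbox]) (use assms(1) continuous_on_subset in blast)
  moreover have "(\<lambda>x. indicator (cbox a b) x *\<^sub>R g x) = g"
    using assms(2) by (auto simp: fun_eq_iff indicator_def)
  ultimately show int: "integrable lborel g" by simp
  have "(\<lambda>x. if x \<in> cbox a b then g x else 0) = g"
    using assms(2) by (auto simp: fun_eq_iff)
  then have "integral (cbox a b) g = integral UNIV g"
    using integral_restrict_UNIV[of "cbox a b" g] by simp
  then show "integral\<^sup>L lborel g = integral (cbox a b) g"
    using integral_lborel[OF int] by simp
qed

lemma dderiv_eq_0:
  fixes G :: "'a::euclidean_space \<Rightarrow> 'b::real_normed_vector"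
  assumes "open S" "x \<in> S" "\<And>y. y \<in> S \<Longrightarrow> G y = 0"
  shows "dderiv v G x = 0"
  using dderiv_cong[OF assms(1,2), of G "\<lambda>_. 0" v] assms(3) by simp

text \<open>Chain rule for the two embeddings into the product: partial derivatives in space and
  time become directional derivatives along \<open>(v, 0)\<close> and \<open>(0, v)\<close>.\<close>

lemma dderiv_slice:
  fixes G :: "'a::euclidean_space \<times> 'c::euclidean_space \<Rightarrow> 'b::real_normed_vector"
  assumes "G differentiable (at (x, t))"
  shows "((\<lambda>x. G (x, t)) has_derivative (\<lambda>v. dderiv (v, 0) G (x, t))) (at x)"
    "((\<lambda>t. G (x, t)) has_derivative (\<lambda>v. dderiv (0, v) G (x, t))) (at t)"
proof -
  have "((\<lambda>x. (x, t)) has_derivative (\<lambda>v. (v, 0))) (at x)"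
    "((\<lambda>t. (x, t)) has_derivative (\<lambda>v. (0, v))) (at t)"
    by (auto intro!: derivative_eq_intros)
  from this[THEN has_derivative_compose, OF has_derivative_dderiv[OF assms]]
  show "((\<lambda>x. G (x, t)) has_derivative (\<lambda>v. dderiv (v, 0) G (x, t))) (at x)"
    "((\<lambda>t. G (x, t)) has_derivative (\<lambda>v. dderiv (0, v) G (x, t))) (at t)" .
qed

lemma has_real_derivative_slice:
  fixes G :: "'a::euclidean_space \<times> real \<Rightarrow> real"
  assumes "G differentiable (at (x, t))"
  shows "((\<lambda>s. G (x, s)) has_real_derivative dderiv (0, 1) G (x, t)) (at t)"
proof -
  have D: "((\<lambda>s. G (x, s)) has_derivative (\<lambda>v. dderiv (0, v) G (x, t))) (at t)"
    by (rule dderiv_slice(2)[OF assms])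
  have "(\<lambda>v. dderiv (0, v) G (x, t)) = (*) (dderiv (0, 1) G (x, t))"
  proof
    fix v
    show "dderiv (0, v) G (x, t) = dderiv (0, 1) G (x, t) * v"
      using linear_cmul[OF linear_frechet_derivative[OF assms], of v "(0, 1)"] by simp
  qed
  from D[unfolded this] show ?thesis unfolding has_field_derivative_def .
qed

text \<open>All slices of \<open>G\<close> and their derivatives vanish off one box around
  \<open>K\<close>, so the Leibniz rule on that box applies. Integrability is stated for every
  direction \<open>v\<close> because spatial derivatives are integrated too.\<close>

lemma leibniz_compact_support:
  fixes G :: "'a::euclidean_space \<times> real \<Rightarrow> real"
  assumes I: "open I" "t \<in> I" and G: "Ck_on 1 G (UNIV \<times> I)"
    and K: "compact K" "\<And>x s. s \<in> I \<Longrightarrow> x \<notin> K \<Longrightarrow> G (x, s) = 0"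
  shows "integrable lborel (\<lambda>x. dderiv v G (x, t))"
    and "((\<lambda>s. LINT x|lborel. G (x, s)) has_real_derivative (LINT x|lborel. dderiv (0, 1) G (x, t))) (at t)"
proof -
  obtain r where r: "r > 0" "ball t r \<subseteq> I"
    using I open_contains_ball by blast
  obtain a b where ab: "K \<subseteq> cbox a b"
    using K(1) bounded_subset_cbox_symmetric compact_imp_bounded by metis
  have cont: "continuous_on (UNIV \<times> I) G" "continuous_on (UNIV \<times> I) (dderiv v G)" for v
    using G[unfolded Ck_on_1] Ck_on_imp_continuous_on[OF G] by blast+
  have diff: "G differentiable (at (x, s))" if "s \<in> I" for x s
    using G[unfolded Ck_on_1] that by blast
  \<comment> \<open>\<open>G\<close> vanishes on the whole open set \<open>(- K) \<times> I\<close>,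
    hence so do its derivatives.\<close>
  have zero: "dderiv v G (x, s) = 0" if "s \<in> I" "x \<notin> K" for x s v
    by (rule dderiv_eq_0[of "(- K) \<times> I"])
      (use I K that in \<open>auto intro: open_Times compact_imp_closed simp: open_Compl\<close>)
  have cont_slice: "continuous_on UNIV (\<lambda>x. G (x, s))"
    "continuous_on UNIV (\<lambda>x. dderiv v G (x, s))" if "s \<in> I" for s v
    by (rule continuous_on_compose2[OF cont(1)] continuous_on_compose2[OF cont(2)],
        use that in \<open>auto intro!: continuous_intros\<close>)+
  show "integrable lborel (\<lambda>x. dderiv v G (x, t))"
    by (rule lborel_integral_eq_integral_cbox(1)[of _ a b]) (use cont_slice[OF I(2)] zero[OF I(2)] ab in blast)+
  have "((\<lambda>s. integral (cbox a b) (\<lambda>x. G (x, s))) has_real_derivative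
      integral (cbox a b) (\<lambda>x. dderiv (0, 1) G (x, t))) (at t within ball t r)"
  proof (rule leibniz_rule_field_derivative)
    fix s x assume "s \<in> ball t r" "x \<in> cbox a b"
    then have "s \<in> I" using r(2) by blast
    show "((\<lambda>s. G (x, s)) has_real_derivative dderiv (0, 1) G (x, s)) (at s within ball t r)"
      by (rule has_field_derivative_at_within[OF has_real_derivative_slice[OF diff[OF \<open>s \<in> I\<close>]]])
  next
    fix s assume "s \<in> ball t r"
    then have "s \<in> I" using r(2) by blast
    show "(\<lambda>x. G (x, s)) integrable_on cbox a b"
      by (rule integrable_continuous[OF continuous_on_subset[OF cont_slice(1)[OF \<open>s \<in> I\<close>]]]) simp
  next
    show "continuous_on (ball t r \<times> cbox a b) (\<lambda>(s, x). dderiv (0, 1) G (x, s))"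
      unfolding split_beta
      by (rule continuous_on_compose2[OF cont(2), where f = "\<lambda>p. (snd p, fst p)"])
        (use r(2) in \<open>auto intro!: continuous_intros\<close>)
  qed (use r in auto)
  then have "((\<lambda>s. integral (cbox a b) (\<lambda>x. G (x, s))) has_real_derivative
      integral (cbox a b) (\<lambda>x. dderiv (0, 1) G (x, t))) (at t)"
    using r(1) at_within_open[of t "ball t r"] by simp
  moreover have "integral (cbox a b) (\<lambda>x. dderiv (0, 1) G (x, t))
      = (LINT x|lborel. dderiv (0, 1) G (x, t))"
    by (rule lborel_integral_eq_integral_cbox(2)[symmetric]) (use cont_slice[OF I(2)] zero[OF I(2)] ab in blast)+
  moreover have "integral (cbox a b) (\<lambda>x. G (x, s)) = (LINT x|lborel. G (x, s))" if "s \<in> I" for s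
    by (rule lborel_integral_eq_integral_cbox(2)[symmetric]) (use cont_slice[OF that] K(2)[OF that] ab in blast)+
  ultimately show "((\<lambda>s. LINT x|lborel. G (x, s)) has_real_derivative
      (LINT x|lborel. dderiv (0, 1) G (x, t))) (at t)"
    using has_field_derivative_transform_within_open[of "\<lambda>s. integral (cbox a b) (\<lambda>x. G (x, s))"
        _ t I "\<lambda>s. LINT x|lborel. G (x, s)"] I by simp
qed

text \<open>The integral of \<open>x \<mapsto> g (x + s v)\<close> does not depend on \<open>s\<close>, so its derivative vanishes.\<close>

lemma lborel_integral_dderiv_eq_0:
  fixes g :: "'a::euclidean_space \<Rightarrow> real"
  assumes g: "Ck_on 1 g UNIV" and K: "compact K" "\<And>x. x \<notin> K \<Longrightarrow> g x = 0"
  shows "(LINT x|lborel. dderiv v g x) = 0"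
proof -
  define G where "G = (\<lambda>p::'a \<times> real. g (fst p + snd p *\<^sub>R v))"
  have D: "(G has_derivative (\<lambda>q. dderiv (fst q + snd q *\<^sub>R v) g (fst p + snd p *\<^sub>R v))) (at p)" for p
  proof -
    have "((\<lambda>p::'a \<times> real. fst p + snd p *\<^sub>R v) has_derivative (\<lambda>q. fst q + snd q *\<^sub>R v)) (at p)"
      by (auto intro!: derivative_eq_intros)
    moreover have "g differentiable (at (fst p + snd p *\<^sub>R v))" using g by auto
    ultimately show ?thesis
      unfolding G_def using has_derivative_compose has_derivative_dderiv by blast
  qed
  have "Ck_on 1 G (UNIV \<times> {-1<..<1})"
  proof -
    have "continuous_on UNIV (dderiv w g)" for w using g by auto
    then have "continuous_on S (\<lambda>p. dderiv w g (fst p + snd p *\<^sub>R v))" for w S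
      by (rule continuous_on_compose2) (auto intro!: continuous_intros)
    moreover have "dderiv q G p = dderiv (fst q + snd q *\<^sub>R v) g (fst p + snd p *\<^sub>R v)" for q p
      by (rule dderiv_eqI[OF D])
    moreover have "G differentiable (at p)" for p
      using D unfolding differentiable_def by blast
    ultimately show ?thesis
      unfolding Ck_on_1 by presburger
  qed
  \<comment> \<open>The union of the translates of \<open>K\<close> by
    \<open>- s *\<^sub>R v\<close> with \<open>\<bar>s\<bar> \<le> 1\<close> supports all slices of
    \<open>G\<close> at once.\<close>
  define K' where "K' = (\<lambda>p. fst p - snd p *\<^sub>R v) ` (K \<times> {-1..1})"
  have "compact K'" unfolding K'_def
    by (rule compact_continuous_image) (auto intro!: continuous_intros compact_Times K)
  have "G (x, s) = 0" if "s \<in> {-1<..<1}" "x \<notin> K'" for x s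
  proof -
    have "x + s *\<^sub>R v \<notin> K"
    proof
      assume "x + s *\<^sub>R v \<in> K"
      then have "x \<in> K'"
        unfolding K'_def using that(1) by (intro image_eqI[of _ _ "(x + s *\<^sub>R v, s)"]) auto
      with that show False by simp
    qed
    then show ?thesis by (simp add: G_def K)
  qed
  from leibniz_compact_support(2)[OF _ _ \<open>Ck_on 1 G _\<close> \<open>compact K'\<close> this, of 0]
  have "((\<lambda>s. LINT x|lborel. G (x, s)) has_real_derivative
      (LINT x|lborel. dderiv (0, 1) G (x, 0))) (at 0)"
    by auto
  moreover have "(LINT x|lborel. dderiv (0, 1) G (x, 0)) = (LINT x|lborel. dderiv v g x)"
    by (simp add: dderiv_eqI[OF D])
  moreover have "(LINT x|lborel. G (x, s)) = integral\<^sup>L lborel g" for s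
  proof -
    have "continuous_on UNIV g" using g Ck_on_imp_continuous_on by blast
    then have "g \<in> borel_measurable borel" by (rule borel_measurable_continuous_onI)
    then have "integral\<^sup>L (distr lborel borel ((+) (s *\<^sub>R v))) g = (LINT x|lborel. g (s *\<^sub>R v + x))"
      by (intro integral_distr) auto
    then show ?thesis by (simp add: lborel_distr_plus G_def add.commute)
  qed
  ultimately have "((\<lambda>s::real. integral\<^sup>L lborel g) has_real_derivative
      (LINT x|lborel. dderiv v g x)) (at 0)" by simp
  then show ?thesis using DERIV_unique DERIV_const by blast
qed

text \<open>Transfers the preceding result to a space-time function at a fixed time; applied to each
  component of the cut flux, it makes the integral of the divergence vanish.\<close>

lemma lborel_integral_dderiv_slice_eq_0:
  fixes G :: "'a::euclidean_space \<times> real \<Rightarrow> real"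
  assumes G: "Ck_on 1 G (UNIV \<times> I)" and "t \<in> I" and K: "compact K" "\<And>x. x \<notin> K \<Longrightarrow> G (x, t) = 0"
  shows "(LINT x|lborel. dderiv (v, 0) G (x, t)) = 0"
proof -
  have d: "G differentiable (at (x, t))" for x using G[unfolded Ck_on_1] \<open>t \<in> I\<close> by blast
  have eq: "dderiv w (\<lambda>x. G (x, t)) x = dderiv (w, 0) G (x, t)" for w x
    by (rule dderiv_eqI[OF dderiv_slice(1)[OF d]])
  have "continuous_on (UNIV \<times> I) (dderiv (w, 0) G)" for w using G[unfolded Ck_on_1] by blast
  then have "continuous_on UNIV (\<lambda>x. dderiv (w, 0) G (x, t))" for w
    by (rule continuous_on_compose2) (use \<open>t \<in> I\<close> in \<open>auto intro!: continuous_intros\<close>)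
  then have "Ck_on 1 (\<lambda>x. G (x, t)) UNIV"
    unfolding Ck_on_1 eq using dderiv_slice(1)[OF d] differentiableI by blast
  from lborel_integral_dderiv_eq_0[OF this K, of v] show ?thesis by (simp add: eq)
qed

subsection \<open>Geometry of the level sets of a function with nonvanishing gradient\<close>

text \<open>The gradient is taken along the directions \<open>e i\<close> only, so that the ambient space may have
  further directions such as time.\<close>

locale regular_level_sets =
  fixes \<phi> :: "'a::euclidean_space \<Rightarrow> real" and U :: "'a set" and e :: "'n::finite \<Rightarrow> 'a"
  assumes open_U: "open U" and smooth_\<phi>: "smooth_on \<phi> U"
    and grad_pos: "\<And>z. z \<in> U \<Longrightarrow> (\<Sum>i\<in>UNIV. (dderiv (e i) \<phi> z)\<^sup>2) > 0"
begin

definition slope :: "'a \<Rightarrow> real" where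
  "slope z = sqrt (\<Sum>i\<in>UNIV. (dderiv (e i) \<phi> z)\<^sup>2)"

definition nu :: "'n \<Rightarrow> 'a \<Rightarrow> real" where
  "nu i z = dderiv (e i) \<phi> z * inverse (slope z)"

definition curv :: "'a \<Rightarrow> real" where
  "curv z = (\<Sum>i\<in>UNIV. dderiv (e i) (nu i) z)"

text \<open>The trace of the square of the matrix of derivatives of \<open>nu\<close>; in three
  dimensions it is \<open>H\<^sup>2 - 2 * G\<close>.\<close>

definition curv_sq :: "'a \<Rightarrow> real" where
  "curv_sq z = (\<Sum>i\<in>UNIV. \<Sum>j\<in>UNIV. dderiv (e j) (nu i) z * dderiv (e i) (nu j) z)"

text \<open>The field \<open>[\<nabla>n]n\<close>, the curvature vector of the integral curves of
  the unit normal.\<close>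

definition kappa :: "'n \<Rightarrow> 'a \<Rightarrow> real" where
  "kappa i z = (\<Sum>j\<in>UNIV. nu j z * dderiv (e j) (nu i) z)"

definition dnormal :: "('a \<Rightarrow> real) \<Rightarrow> 'a \<Rightarrow> real" where
  "dnormal g z = (\<Sum>j\<in>UNIV. nu j z * dderiv (e j) g z)"

definition tangrad :: "('a \<Rightarrow> real) \<Rightarrow> 'n \<Rightarrow> 'a \<Rightarrow> real" where
  "tangrad g i z = dderiv (e i) g z - nu i z * dnormal g z"

text \<open>Coordinate form of \<open>tlaplace\<close>; the two are matched in
  \<open>tlaplace_level\<close>.\<close>

definition surf_laplace :: "('a \<Rightarrow> real) \<Rightarrow> 'a \<Rightarrow> real" where
  "surf_laplace g z = (\<Sum>i\<in>UNIV. dderiv (e i) (tangrad g i) z)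
     - (\<Sum>i\<in>UNIV. (\<Sum>j\<in>UNIV. dderiv (e j) (tangrad g i) z * nu j z) * nu i z)"

section \<open>Smoothness of the geometric quantities\<close>

lemma slope_pos: "z \<in> U \<Longrightarrow> slope z > 0"
  using grad_pos by (simp add: slope_def)

lemma smooth_slope: "smooth_on slope U"
  and smooth_nu: "smooth_on (nu i) U"
proof -
  let ?q = "\<lambda>z. \<Sum>i\<in>UNIV. (dderiv (e i) \<phi> z)\<^sup>2"
  have q: "smooth_on ?q U"
    unfolding power2_eq_square
    by (rule smooth_on_sum[OF open_U], rule smooth_on_mult[OF open_U]; rule smooth_on_dderiv[OF smooth_\<phi>])
  have r: "smooth_on (\<lambda>z. inverse (sqrt (?q z))) U"
    by (rule smooth_on_inverse_sqrt[OF open_U q grad_pos])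
  \<comment> \<open>The square root is written as \<open>q * inverse (sqrt q)\<close>, which reduces
    \<open>slope\<close> to the inverse square root.\<close>
  have "smooth_on (\<lambda>z. ?q z * inverse (sqrt (?q z))) U"
    by (rule smooth_on_mult[OF open_U q r])
  moreover have "?q z * inverse (sqrt (?q z)) = slope z" for z
    using real_div_sqrt[of "?q z"] by (simp add: slope_def divide_inverse sum_nonneg)
  ultimately show "smooth_on slope U" by simp
  show "smooth_on (nu i) U"
    using smooth_on_mult[OF open_U smooth_on_dderiv[OF smooth_\<phi>] r]
    by (simp add: nu_def[abs_def] slope_def)
qed

lemma smooth_curv: "smooth_on curv U"
  unfolding curv_def[abs_def]
  by (rule smooth_on_sum[OF open_U], rule smooth_on_dderiv[OF smooth_nu])

lemma smooth_kappa: "smooth_on (kappa i) U"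
  unfolding kappa_def[abs_def]
  by (rule smooth_on_sum[OF open_U], rule smooth_on_mult[OF open_U smooth_nu smooth_on_dderiv[OF smooth_nu]])

lemma smooth_dnormal: "smooth_on g U \<Longrightarrow> smooth_on (dnormal g) U"
  unfolding dnormal_def[abs_def]
  by (rule smooth_on_sum[OF open_U], rule smooth_on_mult[OF open_U smooth_nu smooth_on_dderiv])

lemma smooth_tangrad: "smooth_on g U \<Longrightarrow> smooth_on (tangrad g i) U"
  unfolding tangrad_def[abs_def]
  by (rule smooth_on_diff[OF open_U smooth_on_dderiv smooth_on_mult[OF open_U smooth_nu smooth_dnormal]])

lemma nu_unit: "z \<in> U \<Longrightarrow> (\<Sum>i\<in>UNIV. nu i z * nu i z) = 1"
proof -
  assume "z \<in> U"
  have "(\<Sum>i\<in>UNIV. nu i z * nu i z) = (\<Sum>i\<in>UNIV. (dderiv (e i) \<phi> z)\<^sup>2) * (inverse (slope z))\<^sup>2"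
    unfolding sum_distrib_right by (rule sum.cong) (auto simp: nu_def power2_eq_square)
  also have "(\<Sum>i\<in>UNIV. (dderiv (e i) \<phi> z)\<^sup>2) = (slope z)\<^sup>2"
    by (simp add: slope_def sum_nonneg)
  finally show ?thesis using slope_pos[OF \<open>z \<in> U\<close>] by (simp add: power_inverse)
qed

lemma dderiv_\<phi>: "z \<in> U \<Longrightarrow> dderiv (e i) \<phi> z = slope z * nu i z"
  using slope_pos[of z] by (simp add: nu_def)

section \<open>Pointwise identities for the normal and its derivatives\<close>

context
  fixes z assumes z: "z \<in> U"
begin

lemmas diff_nu = smooth_on_imp_differentiable[OF smooth_nu z]
  and diff_slope = smooth_on_imp_differentiable[OF smooth_slope z]
  and diff_D_nu = smooth_on_imp_differentiable[OF smooth_on_dderiv[OF smooth_nu] z]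
  and diff_curv = smooth_on_imp_differentiable[OF smooth_curv z]
  and diff_kappa = smooth_on_imp_differentiable[OF smooth_kappa z]

text \<open>Differentiate \<open>nu_unit\<close>, an identity on the open set
  \<open>U\<close>.\<close>

lemma nu_perp_dderiv_nu: "(\<Sum>i\<in>UNIV. nu i z * dderiv v (nu i) z) = 0"
proof -
  have "0 = dderiv v (\<lambda>z. \<Sum>i\<in>UNIV. nu i z * nu i z) z"
    using dderiv_cong[OF open_U z, of "\<lambda>z. \<Sum>i\<in>UNIV. nu i z * nu i z" "\<lambda>_. 1" v] nu_unit by simp
  also have "\<dots> = (\<Sum>i\<in>UNIV. dderiv v (nu i) z * nu i z + nu i z * dderiv v (nu i) z)"
    by (subst dderiv_sum) (auto simp: dderiv_mult diff_nu intro!: differentiable_mult)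
  also have "\<dots> = 2 * (\<Sum>i\<in>UNIV. nu i z * dderiv v (nu i) z)"
    unfolding sum_distrib_left by (rule sum.cong) auto
  finally show ?thesis by simp
qed

lemma dderiv_dderiv_\<phi>:
  "dderiv v (dderiv (e i) \<phi>) z = dderiv v slope z * nu i z + slope z * dderiv v (nu i) z"
  using dderiv_cong[OF open_U z, of "dderiv (e i) \<phi>" "\<lambda>z. slope z * nu i z" v] dderiv_\<phi>
    dderiv_mult[OF diff_slope diff_nu] by simp

text \<open>In the product rule for the gradient \<open>slope\<close> times \<open>nu\<close>,
  pairing with \<open>nu\<close> keeps the derivative of \<open>slope\<close> by
  \<open>nu_unit\<close> and kills the rest by \<open>nu_perp_dderiv_nu\<close>.\<close>

lemma dderiv_slope: "dderiv v slope z = (\<Sum>i\<in>UNIV. nu i z * dderiv v (dderiv (e i) \<phi>) z)"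
proof -
  have "(\<Sum>i\<in>UNIV. nu i z * dderiv v (dderiv (e i) \<phi>) z)
      = dderiv v slope z * (\<Sum>i\<in>UNIV. nu i z * nu i z)
        + slope z * (\<Sum>i\<in>UNIV. nu i z * dderiv v (nu i) z)"
    unfolding dderiv_dderiv_\<phi> sum_distrib_left sum.distrib[symmetric]
    by (rule sum.cong) (auto simp: algebra_simps)
  then show ?thesis by (simp add: nu_unit[OF z] nu_perp_dderiv_nu)
qed

text \<open>Symmetry of the Hessian turns the derivative of \<open>slope\<close> along
  \<open>e i\<close> into the derivative of \<open>dderiv (e i) \<phi>\<close> along
  \<open>nu\<close>; the product rule splits it into a normal part and
  \<open>slope z * kappa i z\<close>.\<close>

lemma slope_kappa: "slope z * kappa i z = tangrad slope i z"
proof -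
  have "dderiv (e i) slope z = (\<Sum>j\<in>UNIV. nu j z * dderiv (e j) (dderiv (e i) \<phi>) z)"
    unfolding dderiv_slope
    using dderiv_commute[OF open_U _ z] smooth_\<phi> by (auto simp: smooth_on_def)
  also have "\<dots> = dnormal slope z * nu i z + slope z * kappa i z"
    unfolding dderiv_dderiv_\<phi> dnormal_def kappa_def sum_distrib_left sum_distrib_right
      sum.distrib[symmetric]
    by (rule sum.cong) (auto simp: algebra_simps)
  finally show ?thesis by (simp add: tangrad_def mult.commute)
qed

text \<open>\<open>kappa\<close> is the derivative of \<open>nu\<close> along \<open>nu\<close>, and
  every derivative of a unit field is orthogonal to it.\<close>

lemma nu_perp_kappa: "(\<Sum>i\<in>UNIV. nu i z * kappa i z) = 0"
proof -
  have "(\<Sum>i\<in>UNIV. nu i z * kappa i z)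
      = (\<Sum>i\<in>UNIV. \<Sum>j\<in>UNIV. nu j z * (nu i z * dderiv (e j) (nu i) z))"
    by (simp add: kappa_def sum_distrib_left mult.left_commute)
  also have "\<dots> = (\<Sum>j\<in>UNIV. nu j z * (\<Sum>i\<in>UNIV. nu i z * dderiv (e j) (nu i) z))"
    by (subst sum.swap) (simp add: sum_distrib_left)
  finally show ?thesis by (simp add: nu_perp_dderiv_nu)
qed

lemma nu_perp_tangrad: "(\<Sum>i\<in>UNIV. nu i z * tangrad g i z) = 0"
proof -
  have "(\<Sum>i\<in>UNIV. nu i z * tangrad g i z)
      = dnormal g z - (\<Sum>i\<in>UNIV. nu i z * nu i z) * dnormal g z"
    unfolding sum_distrib_right by (simp add: tangrad_def right_diff_distrib sum_subtractf
        dnormal_def[of g z, symmetric] mult.assoc)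
  then show ?thesis by (simp add: nu_unit[OF z])
qed

text \<open>The product rule leaves \<open>curv_sq\<close> and second derivatives of
  \<open>nu\<close>; commuting the latter turns them into the derivative of the divergence
  \<open>curv\<close> along \<open>nu\<close>.\<close>

lemma div_kappa: "(\<Sum>i\<in>UNIV. dderiv (e i) (kappa i) z) = curv_sq z + dnormal curv z"
proof -
  have comm: "dderiv (e i) (dderiv (e j) (nu k)) z = dderiv (e j) (dderiv (e i) (nu k)) z" for i j k
    by (rule dderiv_commute[OF open_U _ z]) (use smooth_nu in \<open>auto simp: smooth_on_def\<close>)
  have "dderiv (e i) (kappa i) z = (\<Sum>j\<in>UNIV. dderiv (e i) (nu j) z * dderiv (e j) (nu i) z
      + nu j z * dderiv (e j) (dderiv (e i) (nu i)) z)" for i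
    unfolding kappa_def[abs_def]
    by (subst dderiv_sum) (auto simp: dderiv_mult diff_nu diff_D_nu comm[of i] intro!: differentiable_mult)
  then have "(\<Sum>i\<in>UNIV. dderiv (e i) (kappa i) z) = curv_sq z
      + (\<Sum>i\<in>UNIV. \<Sum>j\<in>UNIV. nu j z * dderiv (e j) (dderiv (e i) (nu i)) z)"
    by (simp add: sum.distrib curv_sq_def mult.commute)
  also have "(\<Sum>i\<in>UNIV. \<Sum>j\<in>UNIV. nu j z * dderiv (e j) (dderiv (e i) (nu i)) z)
      = (\<Sum>j\<in>UNIV. nu j z * (\<Sum>i\<in>UNIV. dderiv (e j) (dderiv (e i) (nu i)) z))"
    by (subst sum.swap) (simp add: sum_distrib_left)
  also have "\<dots> = dnormal curv z"
    unfolding dnormal_def curv_def[abs_def] by (simp add: dderiv_sum diff_D_nu)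
  finally show ?thesis .
qed

context
  fixes g :: "'a \<Rightarrow> real" assumes g: "smooth_on g U"
begin

text \<open>The tangential gradient is orthogonal to \<open>nu\<close>, so its normal-normal
  derivative can be moved onto \<open>nu\<close>, where it becomes a pairing with
  \<open>kappa\<close>. As \<open>kappa\<close> is tangential, the full gradient of \<open>g\<close>
  replaces the tangential one.\<close>

lemma surf_laplace_eq:
  "surf_laplace g z = (\<Sum>i\<in>UNIV. dderiv (e i) (tangrad g i) z) + (\<Sum>i\<in>UNIV. dderiv (e i) g z * kappa i z)"
proof -
  note diff_T = smooth_on_imp_differentiable[OF smooth_tangrad[OF g] z]
  have swap: "(\<Sum>i\<in>UNIV. dderiv v (tangrad g i) z * nu i z)
      = - (\<Sum>i\<in>UNIV. tangrad g i z * dderiv v (nu i) z)" for v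
  proof -
    \<comment> \<open>An orthogonality that is to be differentiated must hold at all points of
      \<open>U\<close>, not just at the fixed \<open>z\<close>; hence the exported form of
      \<open>nu_perp_tangrad\<close>.\<close>
    have "0 = dderiv v (\<lambda>z. \<Sum>i\<in>UNIV. tangrad g i z * nu i z) z"
      using dderiv_eq_0[OF open_U z, of "\<lambda>z. \<Sum>i\<in>UNIV. tangrad g i z * nu i z" v]
        regular_level_sets.nu_perp_tangrad[OF regular_level_sets_axioms]
      by (simp add: mult.commute)
    also have "\<dots> = (\<Sum>i\<in>UNIV. dderiv v (tangrad g i) z * nu i z
        + tangrad g i z * dderiv v (nu i) z)"
      by (subst dderiv_sum) (auto simp: dderiv_mult diff_nu diff_T intro!: differentiable_mult)
    finally show ?thesis unfolding sum.distrib by linarith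
  qed
  have "(\<Sum>i\<in>UNIV. (\<Sum>j\<in>UNIV. dderiv (e j) (tangrad g i) z * nu j z) * nu i z)
      = (\<Sum>j\<in>UNIV. nu j z * (\<Sum>i\<in>UNIV. dderiv (e j) (tangrad g i) z * nu i z))"
    unfolding sum_distrib_left sum_distrib_right by (subst sum.swap) (simp add: ac_simps)
  also have "\<dots> = - (\<Sum>j\<in>UNIV. \<Sum>i\<in>UNIV. tangrad g i z * (nu j z * dderiv (e j) (nu i) z))"
    unfolding swap by (simp add: sum_distrib_left sum_negf ac_simps)
  also have "\<dots> = - (\<Sum>i\<in>UNIV. tangrad g i z * kappa i z)"
    by (subst sum.swap) (simp add: kappa_def sum_distrib_left)
  also have "(\<Sum>i\<in>UNIV. tangrad g i z * kappa i z) = (\<Sum>i\<in>UNIV. dderiv (e i) g z * kappa i z)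
      - dnormal g z * (\<Sum>i\<in>UNIV. nu i z * kappa i z)"
    unfolding sum_distrib_left sum_subtractf[symmetric]
    by (rule sum.cong) (auto simp: tangrad_def algebra_simps)
  finally show ?thesis by (simp add: surf_laplace_def nu_perp_kappa)
qed

text \<open>The product rule term pairing the gradient of \<open>g\<close> with \<open>kappa\<close>
  is exactly what \<open>surf_laplace_eq\<close> adds to the divergence of the tangential gradient;
  \<open>div_kappa\<close> supplies the rest.\<close>

lemma div_tangrad_plus_kappa:
  "(\<Sum>i\<in>UNIV. dderiv (e i) (\<lambda>z. tangrad g i z + g z * kappa i z) z)
    = surf_laplace g z + g z * (curv_sq z + dnormal curv z)"
proof -
  note diff_T = smooth_on_imp_differentiable[OF smooth_tangrad[OF g] z]
    and diff_g = smooth_on_imp_differentiable[OF g z]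
  have "dderiv (e i) (\<lambda>z. tangrad g i z + g z * kappa i z) z = dderiv (e i) (tangrad g i) z
     + (dderiv (e i) g z * kappa i z + g z * dderiv (e i) (kappa i) z)" for i
    by (simp add: dderiv_add dderiv_mult diff_T diff_g diff_kappa differentiable_mult)
  then show ?thesis
    by (simp add: sum.distrib surf_laplace_eq div_kappa[symmetric] sum_distrib_left)
qed

text \<open>Product rule together with \<open>slope_kappa\<close>. Up to the factor
  \<open>slope\<close>, the tangential field in the last term of the flux is thus itself a
  tangential gradient.\<close>

lemma slope_tangrad_plus_kappa:
  "slope z * (tangrad g i z + g z * kappa i z) = tangrad (\<lambda>z. g z * slope z) i z"
proof -
  note diff_g = smooth_on_imp_differentiable[OF g z]
  have *: "dderiv v (\<lambda>z. g z * slope z) z = dderiv v g z * slope z + g z * dderiv v slope z" for v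
    by (rule dderiv_mult[OF diff_g diff_slope])
  have "dnormal (\<lambda>z. g z * slope z) z = dnormal g z * slope z + g z * dnormal slope z"
    unfolding dnormal_def * sum_distrib_left sum_distrib_right sum.distrib[symmetric]
    by (rule sum.cong) (auto simp: algebra_simps)
  then have "tangrad (\<lambda>z. g z * slope z) i z = slope z * tangrad g i z + g z * tangrad slope i z"
    by (simp add: tangrad_def * algebra_simps)
  then show ?thesis by (simp add: slope_kappa[symmetric] algebra_simps)
qed

end

end

section \<open>The flux and the transport identity\<close>

definition flux :: "(real \<Rightarrow> real) \<Rightarrow> 'a \<Rightarrow> 'n \<Rightarrow> 'a \<Rightarrow> real" where
  "flux A \<tau> i z = A (curv z) * dderiv \<tau> \<phi> z * nu i z
     + deriv A (curv z) * slope z * dderiv \<tau> (nu i) z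
     - dderiv \<tau> \<phi> z * (tangrad (\<lambda>z. deriv A (curv z)) i z + deriv A (curv z) * kappa i z)"

lemma smooth_compose_curv:
  fixes A :: "real \<Rightarrow> real"
  shows "smooth_on A UNIV \<Longrightarrow> smooth_on (\<lambda>z. A (curv z)) U"
  by (rule smooth_on_compose[OF open_U smooth_curv, of A UNIV]) auto

context
  fixes A :: "real \<Rightarrow> real" and \<tau> :: 'a
  assumes A: "smooth_on A UNIV"
begin

lemma smooth_tangrad_plus_kappa:
  "smooth_on (\<lambda>z. tangrad (\<lambda>z. deriv A (curv z)) i z + deriv A (curv z) * kappa i z) U"
  by (rule smooth_on_add[OF open_U smooth_tangrad smooth_on_mult[OF open_U _ smooth_kappa]];
      rule smooth_compose_curv[OF smooth_on_deriv[OF open_UNIV A]])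

lemma smooth_deriv_curv_slope: "smooth_on (\<lambda>z. deriv A (curv z) * slope z) U"
  by (rule smooth_on_mult[OF open_U smooth_compose_curv[OF smooth_on_deriv[OF open_UNIV A]] smooth_slope])

lemma smooth_flux: "smooth_on (flux A \<tau> i) U"
  unfolding flux_def[abs_def]
  by (rule smooth_on_diff[OF open_U smooth_on_add[OF open_U
        smooth_on_mult[OF open_U smooth_on_mult[OF open_U smooth_compose_curv[OF A] smooth_on_dderiv[OF smooth_\<phi>]]
          smooth_nu]
        smooth_on_mult[OF open_U smooth_deriv_curv_slope smooth_on_dderiv[OF smooth_nu]]]
        smooth_on_mult[OF open_U smooth_on_dderiv[OF smooth_\<phi>] smooth_tangrad_plus_kappa]])

context
  fixes z assumes z: "z \<in> U"
begin

text \<open>\<open>nu\<close> is orthogonal to its own derivatives, to tangential gradients and to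
  \<open>kappa\<close>, so only the first summand of the flux has a normal component.\<close>

lemma nu_flux: "(\<Sum>i\<in>UNIV. nu i z * flux A \<tau> i z) = A (curv z) * dderiv \<tau> \<phi> z"
proof -
  let ?a = "\<lambda>z. deriv A (curv z)"
  have "(\<Sum>i\<in>UNIV. nu i z * flux A \<tau> i z)
    = A (curv z) * dderiv \<tau> \<phi> z * (\<Sum>i\<in>UNIV. nu i z * nu i z)
      + ?a z * slope z * (\<Sum>i\<in>UNIV. nu i z * dderiv \<tau> (nu i) z)
      - dderiv \<tau> \<phi> z * (\<Sum>i\<in>UNIV. nu i z * tangrad ?a i z)
      - dderiv \<tau> \<phi> z * ?a z * (\<Sum>i\<in>UNIV. nu i z * kappa i z)"
    unfolding sum_distrib_left sum_subtractf[symmetric] sum.distrib[symmetric]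
    by (rule sum.cong) (auto simp: flux_def algebra_simps)
  then show ?thesis
    by (simp add: nu_unit[OF z] nu_perp_dderiv_nu[OF z] nu_perp_tangrad[OF z] nu_perp_kappa[OF z])
qed

text \<open>After the product rule the two mixed terms cancel by \<open>s5\<close>, and the normal
  derivative of \<open>curv\<close> cancels between \<open>s1\<close> and \<open>s6\<close>.
  Commuting derivatives yields those of \<open>slope\<close> and \<open>curv\<close> along
  \<open>\<tau>\<close>.\<close>

lemma div_flux:
  "(\<Sum>i\<in>UNIV. dderiv (e i) (flux A \<tau> i) z) = A (curv z) * dderiv \<tau> slope z
    + deriv A (curv z) * slope z * dderiv \<tau> curv z
    + dderiv \<tau> \<phi> z * (A (curv z) * curv z - surf_laplace (\<lambda>z. deriv A (curv z)) z
        - deriv A (curv z) * curv_sq z)"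
proof -
  define a where "a = (\<lambda>z. deriv A (curv z))"
  define \<alpha> where "\<alpha> = (\<lambda>z. A (curv z))"
  define \<psi> where "\<psi> = dderiv \<tau> \<phi>"
  define B where "B = (\<lambda>i z. tangrad a i z + a z * kappa i z)"
  define g where "g = (\<lambda>z. a z * slope z)"
  have sm_a: "smooth_on a U"
    unfolding a_def by (rule smooth_compose_curv[OF smooth_on_deriv[OF open_UNIV A]])
  have da: "\<alpha> differentiable (at z)" "\<psi> differentiable (at z)" "B i differentiable (at z)"
    "g differentiable (at z)" for i
    unfolding \<alpha>_def \<psi>_def B_def a_def g_def
    using smooth_compose_curv[OF A] smooth_on_dderiv[OF smooth_\<phi>] smooth_tangrad_plus_kappa
      smooth_deriv_curv_slope z smooth_on_imp_differentiable by blast+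
  have d\<alpha>: "dderiv v \<alpha> z = a z * dderiv v curv z" for v
    unfolding \<alpha>_def a_def
    by (rule dderiv_compose[OF diff_curv[OF z] smooth_on_imp_differentiable[OF A UNIV_I]])
  have commute_\<phi>: "dderiv v \<psi> z = dderiv \<tau> (dderiv v \<phi>) z" for v
    unfolding \<psi>_def by (rule dderiv_commute[OF open_U _ z]) (use smooth_\<phi> in \<open>auto simp: smooth_on_def\<close>)
  have commute_nu: "dderiv v (dderiv w (nu i)) z = dderiv w (dderiv v (nu i)) z" for v w i
    by (rule dderiv_commute[OF open_U _ z]) (use smooth_nu in \<open>auto simp: smooth_on_def\<close>)
  have dflux: "dderiv v (flux A \<tau> i) z = (a z * dderiv v curv z * \<psi> z + \<alpha> z * dderiv v \<psi> z) * nu i z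
      + \<alpha> z * \<psi> z * dderiv v (nu i) z
      + (dderiv v g z * dderiv \<tau> (nu i) z + g z * dderiv v (dderiv \<tau> (nu i)) z)
      - (dderiv v \<psi> z * B i z + \<psi> z * dderiv v (B i) z)" for v i
  proof -
    have "flux A \<tau> i = (\<lambda>z. \<alpha> z * \<psi> z * nu i z + g z * dderiv \<tau> (nu i) z - \<psi> z * B i z)"
      by (simp add: fun_eq_iff flux_def \<alpha>_def \<psi>_def g_def B_def a_def)
    then show ?thesis
      by (simp add: dderiv_diff dderiv_add dderiv_mult da diff_nu[OF z] diff_D_nu[OF z] differentiable_mult
          differentiable_add d\<alpha>)
  qed
  have s1: "(\<Sum>i\<in>UNIV. dderiv (e i) curv z * nu i z) = dnormal curv z"
    by (simp add: dnormal_def mult.commute)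
  have s2: "(\<Sum>i\<in>UNIV. dderiv (e i) \<psi> z * nu i z) = dderiv \<tau> slope z"
    by (simp add: commute_\<phi> dderiv_slope[OF z] mult.commute)
  have s3: "(\<Sum>i\<in>UNIV. dderiv (e i) (nu i) z) = curv z"
    by (simp add: curv_def)
  have s4: "(\<Sum>i\<in>UNIV. dderiv (e i) (dderiv \<tau> (nu i)) z) = dderiv \<tau> curv z"
    unfolding commute_nu[of _ \<tau>] curv_def[abs_def] by (subst dderiv_sum) (auto simp: diff_D_nu[OF z])
  \<comment> \<open>The gradient of \<open>\<psi>\<close> is \<open>dderiv \<tau> slope\<close>
    times \<open>nu\<close> plus \<open>slope\<close> times the \<open>\<tau>\<close>-derivative of
    \<open>nu\<close>. The first part is orthogonal to \<open>B\<close>; \<open>slope\<close> times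
    \<open>B\<close> is the tangential gradient of \<open>g\<close>, whose normal correction
    vanishes against the second part.\<close>
  have s5: "(\<Sum>i\<in>UNIV. dderiv (e i) \<psi> z * B i z) = (\<Sum>i\<in>UNIV. dderiv (e i) g z * dderiv \<tau> (nu i) z)"
  proof -
    have sB: "slope z * B i z = dderiv (e i) g z - nu i z * dnormal g z" for i
      using slope_tangrad_plus_kappa[OF z sm_a, of i] unfolding B_def g_def tangrad_def .
    have *: "dderiv (e i) \<psi> z * B i z = dderiv \<tau> slope z * (nu i z * B i z)
        + dderiv \<tau> (nu i) z * (slope z * B i z)" for i
      by (simp add: commute_\<phi> dderiv_dderiv_\<phi>[OF z] algebra_simps)
    have "(\<Sum>i\<in>UNIV. dderiv (e i) \<psi> z * B i z)
       = dderiv \<tau> slope z * (\<Sum>i\<in>UNIV. nu i z * B i z)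
         + ((\<Sum>i\<in>UNIV. dderiv (e i) g z * dderiv \<tau> (nu i) z)
         - dnormal g z * (\<Sum>i\<in>UNIV. nu i z * dderiv \<tau> (nu i) z))"
      unfolding * sB sum_distrib_left sum_subtractf[symmetric] sum.distrib[symmetric]
      by (rule sum.cong) (auto simp: algebra_simps)
    moreover have "(\<Sum>i\<in>UNIV. nu i z * B i z)
        = (\<Sum>i\<in>UNIV. nu i z * tangrad a i z) + a z * (\<Sum>i\<in>UNIV. nu i z * kappa i z)"
      by (simp add: B_def sum.distrib sum_distrib_left algebra_simps)
    ultimately show ?thesis
      by (simp add: nu_perp_dderiv_nu[OF z] nu_perp_tangrad[OF z] nu_perp_kappa[OF z])
  qed
  have s6: "(\<Sum>i\<in>UNIV. dderiv (e i) (B i) z) = surf_laplace a z + a z * (curv_sq z + dnormal curv z)"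
    unfolding B_def by (rule div_tangrad_plus_kappa[OF z sm_a])
  have "(\<Sum>i\<in>UNIV. dderiv (e i) (flux A \<tau> i) z)
      = a z * \<psi> z * (\<Sum>i\<in>UNIV. dderiv (e i) curv z * nu i z)
        + \<alpha> z * (\<Sum>i\<in>UNIV. dderiv (e i) \<psi> z * nu i z)
        + \<alpha> z * \<psi> z * (\<Sum>i\<in>UNIV. dderiv (e i) (nu i) z)
        + ((\<Sum>i\<in>UNIV. dderiv (e i) g z * dderiv \<tau> (nu i) z)
          + g z * (\<Sum>i\<in>UNIV. dderiv (e i) (dderiv \<tau> (nu i)) z))
        - ((\<Sum>i\<in>UNIV. dderiv (e i) \<psi> z * B i z) + \<psi> z * (\<Sum>i\<in>UNIV. dderiv (e i) (B i) z))"
    unfolding dflux sum_distrib_left sum_subtractf[symmetric] sum.distrib[symmetric]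
    by (rule sum.cong) (auto simp: algebra_simps)
  then show ?thesis
    unfolding s1 s2 s3 s4 s5 s6 by (simp add: \<alpha>_def a_def \<psi>_def g_def algebra_simps)
qed

text \<open>The weight \<open>Z\<close> has a gradient parallel to that of \<open>\<phi>\<close>, so
  its derivatives enter through \<open>c\<close> and cancel by \<open>nu_flux\<close>; the
  derivatives of \<open>slope\<close> and \<open>curv\<close> along \<open>\<tau>\<close> cancel by
  \<open>div_flux\<close>.\<close>

lemma transport_identity:
  assumes Z: "Z differentiable (at z)" "\<And>v. dderiv v Z z = c * dderiv v \<phi> z"
  shows "dderiv \<tau> (\<lambda>z. Z z * (A (curv z) * slope z)) z
      - (\<Sum>i\<in>UNIV. dderiv (e i) (\<lambda>z. Z z * flux A \<tau> i z) z)
    = Z z * dderiv \<tau> \<phi> z * (surf_laplace (\<lambda>z. deriv A (curv z)) z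
        + deriv A (curv z) * curv_sq z - A (curv z) * curv z)"
proof -
  have d\<alpha>: "(\<lambda>z. A (curv z)) differentiable (at z)"
    "dderiv \<tau> (\<lambda>z. A (curv z)) z = deriv A (curv z) * dderiv \<tau> curv z"
    using smooth_on_imp_differentiable[OF smooth_compose_curv[OF A] z]
      dderiv_compose[OF diff_curv[OF z] smooth_on_imp_differentiable[OF A UNIV_I]] by auto
  have "dderiv \<tau> (\<lambda>z. Z z * (A (curv z) * slope z)) z = c * dderiv \<tau> \<phi> z * (A (curv z) * slope z)
      + Z z * (deriv A (curv z) * dderiv \<tau> curv z * slope z + A (curv z) * dderiv \<tau> slope z)"
    by (simp add: dderiv_mult Z d\<alpha> diff_slope[OF z] differentiable_mult)
  moreover have "(\<Sum>i\<in>UNIV. dderiv (e i) (\<lambda>z. Z z * flux A \<tau> i z) z)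
      = c * slope z * (\<Sum>i\<in>UNIV. nu i z * flux A \<tau> i z)
        + Z z * (\<Sum>i\<in>UNIV. dderiv (e i) (flux A \<tau> i) z)"
    unfolding sum_distrib_left sum.distrib[symmetric]
    by (rule sum.cong) (auto simp: dderiv_mult Z smooth_on_imp_differentiable[OF smooth_flux z] dderiv_\<phi>[OF z])
  ultimately show ?thesis
    unfolding nu_flux div_flux by (simp add: algebra_simps)
qed

end

end

end

subsection \<open>Level sets of a time slice\<close>

text \<open>The operators of the theorem act on functions at a frozen time, which match space-time
  functions on a slice of \<open>U\<close>. That slice is open, so derivatives carry over.\<close>

lemma has_derivative_slice_transfer:
  fixes w :: "'a::euclidean_space \<times> real \<Rightarrow> 'b::real_normed_vector"
  assumes U: "open U" "(x, t) \<in> U" and w: "w differentiable (at (x, t))"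
    and g: "\<And>y. (y, t) \<in> U \<Longrightarrow> g y = w (y, t)"
  shows "(g has_derivative (\<lambda>v. dderiv (v, 0) w (x, t))) (at x)"
proof (rule has_derivative_transform_within_open[OF dderiv_slice(1)[OF w]])
  show "open ((\<lambda>y. (y, t)) -` U)"
    by (rule open_vimage[OF U(1)]) (auto intro!: continuous_intros)
qed (use U g in auto)

lemma jacobian_slice:
  fixes V :: "real^'n \<Rightarrow> real^'m" and W :: "'m \<Rightarrow> (real^'n) \<times> real \<Rightarrow> real"
  assumes U: "open U" "(x, t) \<in> U" and W: "\<And>i. W i differentiable (at (x, t))"
    and V: "\<And>y i. (y, t) \<in> U \<Longrightarrow> V y $ i = W i (y, t)"
  shows "jacobian V (at x) $ i $ j = dderiv (axis j 1, 0) (W i) (x, t)"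
proof -
  have "((\<lambda>y. V y $ i) has_derivative (\<lambda>v. dderiv (v, 0) (W i) (x, t))) (at x)" for i
    by (rule has_derivative_slice_transfer[OF U W V])
  then have "(V has_derivative (\<lambda>v. \<chi> i. dderiv (v, 0) (W i) (x, t))) (at x)"
    by (subst has_derivative_componentwise_within) (auto simp: Basis_vec_def inner_axis)
  from dderiv_eqI[OF this] show ?thesis by (simp add: jacobian_def matrix_def)
qed

text \<open>The directions \<open>e i\<close> are the spatial axes of space-time; time remains as
  the direction \<open>(0, 1)\<close>, available for \<open>\<tau>\<close> in the flux.\<close>

locale moving_level_sets = regular_level_sets \<phi> U "\<lambda>i. (axis i 1, 0)"
  for \<phi> :: "(real^'n) \<times> real \<Rightarrow> real" and U
begin

context
  fixes x :: "real^'n" and t :: real assumes xt: "(x, t) \<in> U"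
begin

lemma grad_slice:
  assumes "w differentiable (at (x, t))" "\<And>y. (y, t) \<in> U \<Longrightarrow> g y = w (y, t)"
  shows "grad g x $ i = dderiv (axis i 1, 0) w (x, t)"
  using dderiv_eqI[OF has_derivative_slice_transfer[OF open_U xt assms]] by (simp add: grad_def)

lemma grad_level: "grad (\<lambda>y. \<phi> (y, t)) x $ i = dderiv (axis i 1, 0) \<phi> (x, t)"
  by (rule grad_slice[OF smooth_on_imp_differentiable[OF smooth_\<phi> xt]]) simp

lemma norm_grad_level: "norm (grad (\<lambda>y. \<phi> (y, t)) x) = slope (x, t)"
  by (simp add: norm_vec_def L2_set_def grad_level slope_def)

lemma normal_field_level: "normal_field (\<lambda>y. \<phi> (y, t)) x $ i = nu i (x, t)"
  by (simp add: normal_field_def norm_grad_level grad_level nu_def)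

end

text \<open>Reopening the context makes the formulas above available at all points of the slice, as
  required for differentiating once more.\<close>

context
  fixes x :: "real^'n" and t :: real assumes xt: "(x, t) \<in> U"
begin

lemma jacobian_normal_field_level:
  "jacobian (normal_field (\<lambda>y. \<phi> (y, t))) (at x) $ i $ j = dderiv (axis j 1, 0) (nu i) (x, t)"
  by (rule jacobian_slice[OF open_U xt diff_nu[OF xt] normal_field_level])

lemma mean_curv_level: "mean_curv (\<lambda>y. \<phi> (y, t)) x = curv (x, t)"
  by (simp add: mean_curv_def divg_def trace_def jacobian_normal_field_level curv_def)

lemma curv_sq_level:
  "trace (jacobian (normal_field (\<lambda>y. \<phi> (y, t))) (at x) ** jacobian (normal_field (\<lambda>y. \<phi> (y, t))) (at x))
    = curv_sq (x, t)"
  by (simp add: trace_def matrix_matrix_mult_def jacobian_normal_field_level curv_sq_def)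

lemma tlaplace_level:
  assumes w: "smooth_on w U" and g: "\<And>y. (y, t) \<in> U \<Longrightarrow> g y = w (y, t)"
  shows "tlaplace (normal_field (\<lambda>y. \<phi> (y, t))) g x = surf_laplace w (x, t)"
proof -
  let ?n = "normal_field (\<lambda>y. \<phi> (y, t))"
  have T: "tgrad ?n g y $ i = tangrad w i (y, t)" if y: "(y, t) \<in> U" for y i
    using grad_slice[OF y smooth_on_imp_differentiable[OF w y] g] normal_field_level[OF y]
    by (simp add: tgrad_def tangrad_def dnormal_def inner_vec_def mult.commute)
  have J: "jacobian (tgrad ?n g) (at x) $ i $ j = dderiv (axis j 1, 0) (tangrad w i) (x, t)" for i j
    by (rule jacobian_slice[OF open_U xt smooth_on_imp_differentiable[OF smooth_tangrad[OF w] xt] T])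
  show ?thesis
    by (simp add: tlaplace_def tdivg_def divg_def trace_def J surf_laplace_def inner_vec_def
        matrix_vector_mult_def normal_field_level[OF xt])
qed

end

end

text \<open>The three-dimensional formula for the trace of the cofactor matrix; through it
  \<open>H\<^sup>2 - 2 * G\<close> becomes \<open>curv_sq\<close>.\<close>

lemma gauss_curv_eq:
  "2 * gauss_curv f x = (mean_curv f x)\<^sup>2
    - trace (jacobian (normal_field f) (at x) ** jacobian (normal_field f) (at x))"
  by (simp add: gauss_curv_def trace_Cof_3 mean_curv_def divg_def)

subsection \<open>Integrands concentrated near the zero level set\<close>

text \<open>Here \<open>\<eta>\<close> stands for the scaled profile, with value
  \<open>\<zeta> (s / \<epsilon>) / \<epsilon>\<close> at \<open>s\<close>.\<close>

locale smeared_level_sets =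
  fixes Q K :: "(real^'n) set" and I :: "real set" and \<epsilon> :: real
    and \<phi> :: "(real^'n) \<times> real \<Rightarrow> real" and \<eta> :: "real \<Rightarrow> real"
  assumes open_Q: "open Q" and open_I: "open I"
    and smooth_phi: "smooth_on \<phi> (UNIV \<times> I)"
    and compact_K: "compact K" and K_Q: "K \<subseteq> Q"
    and level_K: "\<And>x t. t \<in> I \<Longrightarrow> x \<in> Q \<Longrightarrow> \<bar>\<phi> (x, t)\<bar> \<le> \<epsilon> \<Longrightarrow> x \<in> K"
    and grad_nz: "\<And>x t. t \<in> I \<Longrightarrow> x \<in> Q \<Longrightarrow> \<bar>\<phi> (x, t)\<bar> \<le> \<epsilon> \<Longrightarrow> grad (\<lambda>y. \<phi> (y, t)) x \<noteq> 0"
    and C1_\<eta>: "Ck_on 1 \<eta> UNIV" and \<eta>_0: "\<And>s. \<bar>s\<bar> > \<epsilon> \<Longrightarrow> \<eta> s = 0"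
begin

text \<open>Described by the spatial gradient instead of the closed condition
  \<open>\<bar>\<phi> z\<bar> \<le> \<epsilon>\<close>, so that the set is open.\<close>

definition regular :: "((real^'n) \<times> real) set" where
  "regular = (UNIV \<times> I) \<inter> (\<lambda>z. \<Sum>i\<in>UNIV. (dderiv (axis i 1, 0) \<phi> z)\<^sup>2) -` {0<..}"

lemma open_UNIV_I: "open (UNIV \<times> I :: ((real^'n) \<times> real) set)"
  by (simp add: open_Times open_I)

lemma open_regular: "open regular"
  unfolding regular_def
proof (rule continuous_open_preimage[OF _ open_UNIV_I])
  have "continuous_on (UNIV \<times> I) (dderiv v \<phi>)" for v
    using smooth_on_dderiv[OF smooth_phi] Ck_on_imp_continuous_on unfolding smooth_on_def by blast
  then show "continuous_on (UNIV \<times> I) (\<lambda>z. \<Sum>i\<in>UNIV. (dderiv (axis i 1, 0) \<phi> z)\<^sup>2)"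
    by (intro continuous_on_sum continuous_on_power)
qed simp

sublocale moving_level_sets \<phi> regular
proof
  show "open regular" by (rule open_regular)
  show "smooth_on \<phi> regular"
    by (rule smooth_on_subset[OF smooth_phi]) (auto simp: regular_def)
  show "0 < (\<Sum>i\<in>UNIV. (dderiv (axis i 1, 0) \<phi> z)\<^sup>2)" if "z \<in> regular" for z
    using that by (simp add: regular_def)
qed

lemma diff_phi: "t \<in> I \<Longrightarrow> \<phi> differentiable (at (x, t))"
  using smooth_on_imp_differentiable[OF smooth_phi] by auto

lemma grad_phi: "t \<in> I \<Longrightarrow> grad (\<lambda>y. \<phi> (y, t)) x $ i = dderiv (axis i 1, 0) \<phi> (x, t)"
  using dderiv_eqI[OF dderiv_slice(1)[OF diff_phi]] by (simp add: grad_def)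

lemma regularI:
  assumes "t \<in> I" "x \<in> Q" "\<bar>\<phi> (x, t)\<bar> \<le> \<epsilon>"
  shows "(x, t) \<in> regular"
proof -
  obtain i where "grad (\<lambda>y. \<phi> (y, t)) x $ i \<noteq> 0"
    using grad_nz[OF assms] by (auto simp: vec_eq_iff)
  then have "0 < (\<Sum>i\<in>UNIV. (dderiv (axis i 1, 0) \<phi> (x, t))\<^sup>2)"
    using assms(1) by (intro sum_pos2[of UNIV i]) (auto simp: grad_phi)
  then show ?thesis using assms(1) by (simp add: regular_def)
qed

text \<open>The value 0 is imposed outside \<open>Q\<close>, where nothing is known about the level
  sets, and where \<open>\<bar>\<phi> z\<bar> > \<epsilon>\<close>, where the gradient may vanish
  and \<open>g\<close> lose its meaning.\<close>

definition cut :: "((real^'n) \<times> real \<Rightarrow> real) \<Rightarrow> (real^'n) \<times> real \<Rightarrow> real" where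
  "cut g z = (if fst z \<in> Q \<and> \<bar>\<phi> z\<bar> \<le> \<epsilon> then \<eta> (\<phi> z) * g z else 0)"

lemma cut_outside_K: "t \<in> I \<Longrightarrow> x \<notin> K \<Longrightarrow> cut g (x, t) = 0"
  using level_K by (auto simp: cut_def)

lemma C1_eta_phi: "Ck_on 1 (\<lambda>z. \<eta> (\<phi> z)) regular"
  by (rule Ck_on_compose[OF open_regular _ C1_\<eta>]) (use smooth_\<phi> in \<open>auto simp: smooth_on_def simp del: Ck_on.simps\<close>)

lemma dderiv_eta_phi: "z \<in> regular \<Longrightarrow> dderiv v (\<lambda>z. \<eta> (\<phi> z)) z = deriv \<eta> (\<phi> z) * dderiv v \<phi> z"
  by (rule dderiv_compose[OF smooth_on_imp_differentiable[OF smooth_\<phi>]])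
    (use C1_\<eta>[unfolded Ck_on_1] in auto)

text \<open>Near a point of \<open>Q\<close> with \<open>\<bar>\<phi>\<bar> \<le> \<epsilon>\<close> the cut-off is redundant because \<open>\<eta> (\<phi> z)\<close> vanishes
  where \<open>\<bar>\<phi> z\<bar> > \<epsilon>\<close>; near all other points the cut-off function is \<open>0\<close>.\<close>

lemma
  assumes g: "smooth_on g regular"
  shows C1_cut: "Ck_on 1 (cut g) (UNIV \<times> I)"
    and dderiv_cut: "t \<in> I \<Longrightarrow> dderiv v (cut g) (x, t)
      = (if x \<in> Q \<and> \<bar>\<phi> (x, t)\<bar> \<le> \<epsilon> then dderiv v (\<lambda>z. \<eta> (\<phi> z) * g z) (x, t) else 0)"
proof -
  define V where "V = regular \<inter> (Q \<times> UNIV)"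
  define N where "N = ((- K) \<times> I) \<union> ((UNIV \<times> I) \<inter> \<phi> -` (- {-\<epsilon>..\<epsilon>}))"
  have V: "open V" unfolding V_def by (intro open_Int open_regular open_Times open_Q open_UNIV)
  have "continuous_on (UNIV \<times> I) \<phi>"
    using smooth_phi Ck_on_imp_continuous_on unfolding smooth_on_def by blast
  then have N: "open N"
    unfolding N_def using compact_K
    by (intro open_Un open_Times continuous_open_preimage open_UNIV_I open_I)
      (auto simp: open_Compl compact_imp_closed)
  have eq_V: "\<eta> (\<phi> z) * g z = cut g z" if "z \<in> V" for z
    using that \<eta>_0 by (auto simp: V_def cut_def)
  have eq_N: "cut g z = 0" if "z \<in> N" for z
    using that level_K by (auto simp: N_def cut_def)
  \<comment> \<open>A point outside \<open>N\<close> has \<open>x \<in> K\<close>, hence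
    \<open>x \<in> Q\<close>, and \<open>\<bar>\<phi> z\<bar> \<le> \<epsilon>\<close>, so
    \<open>regularI\<close> puts it into \<open>V\<close>.\<close>
  have cover: "UNIV \<times> I \<subseteq> V \<union> N"
    using regularI K_Q by (force simp: V_def N_def)
  have "Ck_on 1 (\<lambda>z. \<eta> (\<phi> z) * g z) regular"
    using Ck_on_mult[OF open_regular C1_eta_phi] g unfolding smooth_on_def by blast
  then have "Ck_on 1 (\<lambda>z. \<eta> (\<phi> z) * g z) V"
    by (rule Ck_on_subset) (simp add: V_def)
  then have "Ck_on 1 (cut g) V"
    by (rule Ck_on_cong[OF V eq_V, rotated])
  moreover have "Ck_on 1 (cut g) N"
    by (rule Ck_on_cong[OF N _ Ck_on_const[of 1 0]]) (use eq_N in auto)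
  ultimately show "Ck_on 1 (cut g) (UNIV \<times> I)"
    using Ck_on_subset[OF Ck_on_Un[OF V N] cover] by blast
  show "dderiv v (cut g) (x, t)
      = (if x \<in> Q \<and> \<bar>\<phi> (x, t)\<bar> \<le> \<epsilon> then dderiv v (\<lambda>z. \<eta> (\<phi> z) * g z) (x, t) else 0)" if "t \<in> I"
  proof (cases "x \<in> Q \<and> \<bar>\<phi> (x, t)\<bar> \<le> \<epsilon>")
    case True
    then have "(x, t) \<in> V" using regularI[OF that] by (simp add: V_def)
    then show ?thesis using True dderiv_cong[OF V _ eq_V[symmetric], of "(x, t)"] by simp
  next
    case False
    then have "(x, t) \<in> N" using K_Q that by (auto simp: N_def)
    then have "dderiv v (cut g) (x, t) = 0" by (rule dderiv_eq_0[OF N _ eq_N])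
    then show ?thesis using False by auto
  qed
qed

text \<open>The new integrand is the time derivative of the cut density minus the divergence of the
  cut flux, and that divergence integrates to zero.\<close>

lemma has_real_derivative_integral_cut:
  assumes A: "smooth_on A UNIV" and t: "t \<in> I"
  shows "((\<lambda>s. LINT x|lborel. cut (\<lambda>z. A (curv z) * slope z) (x, s)) has_real_derivative
    (LINT x|lborel. cut (\<lambda>z. dderiv (0, 1) \<phi> z * (surf_laplace (\<lambda>z. deriv A (curv z)) z
        + deriv A (curv z) * curv_sq z - A (curv z) * curv z)) (x, t))) (at t)"
proof -
  let ?F = "\<lambda>z. A (curv z) * slope z"
  let ?W = "\<lambda>i. cut (flux A (0, 1) i)"
  let ?R = "cut (\<lambda>z. dderiv (0, 1) \<phi> z * (surf_laplace (\<lambda>z. deriv A (curv z)) z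
        + deriv A (curv z) * curv_sq z - A (curv z) * curv z))"
  have F: "smooth_on ?F regular"
    by (rule smooth_on_mult[OF open_regular smooth_compose_curv[OF A] smooth_slope])
  \<comment> \<open>Where the cut-off is active this is \<open>transport_identity\<close> with
    direction \<open>(0, 1)\<close> and \<open>c = deriv \<eta> (\<phi> (x, t))\<close>; elsewhere
    every term is 0.\<close>
  have eq: "?R (x, t) = dderiv (0, 1) (cut ?F) (x, t) - (\<Sum>i\<in>UNIV. dderiv (axis i 1, 0) (?W i) (x, t))" for x
  proof (cases "x \<in> Q \<and> \<bar>\<phi> (x, t)\<bar> \<le> \<epsilon>")
    case True
    then have xt: "(x, t) \<in> regular" using regularI t by blast
    have "(\<lambda>z. \<eta> (\<phi> z)) differentiable (at (x, t))"
      using C1_eta_phi[unfolded Ck_on_1] xt by blast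
    from transport_identity[OF A xt this dderiv_eta_phi[OF xt], of "(0, 1)"] True show ?thesis
      by (simp add: cut_def dderiv_cut[OF F t] dderiv_cut[OF smooth_flux[OF A] t] mult.assoc)
  next
    case False
    then show ?thesis
      by (auto simp: cut_def dderiv_cut[OF F t] dderiv_cut[OF smooth_flux[OF A] t])
  qed
  have int: "integrable lborel (\<lambda>x. dderiv v (cut g) (x, t))" if "smooth_on g regular" for g v
    by (rule leibniz_compact_support(1)[OF open_I t C1_cut[OF that] compact_K cut_outside_K])
  have zero: "(LINT x|lborel. dderiv (axis i 1, 0) (?W i) (x, t)) = 0" for i
    by (rule lborel_integral_dderiv_slice_eq_0[OF C1_cut[OF smooth_flux[OF A]] t compact_K cut_outside_K[OF t]])
  have "(LINT x|lborel. ?R (x, t)) = (LINT x|lborel. dderiv (0, 1) (cut ?F) (x, t))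
      - (\<Sum>i\<in>UNIV. LINT x|lborel. dderiv (axis i 1, 0) (?W i) (x, t))"
    unfolding eq
    by (subst Bochner_Integration.integral_diff)
      (auto intro!: int[OF F] int[OF smooth_flux[OF A]] Bochner_Integration.integrable_sum
        Bochner_Integration.integral_sum)
  then have "(LINT x|lborel. ?R (x, t)) = (LINT x|lborel. dderiv (0, 1) (cut ?F) (x, t))"
    by (simp add: zero)
  with leibniz_compact_support(2)[OF open_I t C1_cut[OF F] compact_K cut_outside_K]
  show ?thesis by simp
qed

end

section \<open>The given profile and the smeared integrals\<close>

lemma C1_differentiable_on_imp_Ck_on:
  assumes "\<zeta> C1_differentiable_on UNIV"
  shows "Ck_on 1 \<zeta> UNIV"
proof -
  obtain D where D: "\<And>x. (\<zeta> has_vector_derivative D x) (at x)" "continuous_on UNIV D"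
    using assms unfolding C1_differentiable_on_def by blast
  have *: "dderiv v \<zeta> = (\<lambda>x. v *\<^sub>R D x)" for v
    using dderiv_eqI[OF D(1)[unfolded has_vector_derivative_def]] by (simp add: fun_eq_iff)
  then show ?thesis
    unfolding Ck_on_1 * using D by (auto intro!: continuous_intros differentiableI_vector)
qed

theorem mainTheorem5:
  fixes Q K :: "(real^3) set" and I :: "real set" and \<epsilon> :: real
    and \<phi> :: "(real^3) \<times> real \<Rightarrow> real" and u :: "(real^3) \<times> real \<Rightarrow> real^3"
    and \<zeta> A :: "real \<Rightarrow> real"
  assumes Q: "open Q"
    and I: "open I" "is_interval I"
    and eps: "\<epsilon> > 0"
    and smooth_phi: "smooth_on \<phi> (UNIV \<times> I)"
    and smooth_u: "smooth_on u (UNIV \<times> I)"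
    and transport: "\<And>x t. t \<in> I \<Longrightarrow>
          deriv (\<lambda>s. \<phi> (x, s)) t + u (x, t) \<bullet> grad (\<lambda>y. \<phi> (y, t)) x = 0"
    and K: "compact K" "K \<subseteq> Q"
    and support_K: "\<And>t. t \<in> I \<Longrightarrow> {x \<in> Q. \<bar>\<phi> (x, t)\<bar> \<le> \<epsilon>} \<subseteq> K"
    and grad_pos: "\<And>x t. t \<in> I \<Longrightarrow> x \<in> Q \<Longrightarrow> \<bar>\<phi> (x, t)\<bar> \<le> \<epsilon> \<Longrightarrow>
          norm (grad (\<lambda>y. \<phi> (y, t)) x) > 0"
    and zeta_nonneg: "\<And>s. \<zeta> s \<ge> 0"
    and zeta_C1: "\<zeta> C1_differentiable_on UNIV"
    and zeta_support: "\<And>s. s \<notin> {-1..1} \<Longrightarrow> \<zeta> s = 0"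
    and zeta_integral: "(LINT s|lborel. \<zeta> s) = 1"
    and smooth_A: "smooth_on A UNIV"
  shows "\<forall>t\<in>I.
    (let f = (\<lambda>x. \<phi> (x, t)); n = normal_field f; H = mean_curv f; G = gauss_curv f
     in (JH Q \<epsilon> \<zeta> A \<phi> has_real_derivative
          smeared_integral Q \<epsilon> \<zeta> f
            (\<lambda>x. (A (H x) * H x - tlaplace n (\<lambda>y. deriv A (H y)) x
                    - deriv A (H x) * ((H x)\<^sup>2 - 2 * G x))
                  * (u (x, t) \<bullet> n x))) (at t))"
proof
  fix t assume t: "t \<in> I"
  \<comment> \<open>Division by \<open>\<epsilon>\<close> is written as multiplication by
    \<open>1 / \<epsilon>\<close>, so that \<open>\<eta>\<close> is a constant times a composition
    with a bounded linear map.\<close>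
  define \<eta> where "\<eta> = (\<lambda>s. (1 / \<epsilon>) * \<zeta> (s * (1 / \<epsilon>)))"
  have C1: "Ck_on 1 \<eta> UNIV"
    unfolding \<eta>_def
    by (rule Ck_on_mult[OF open_UNIV Ck_on_const
          Ck_on_compose[OF open_UNIV Ck_on_bounded_linear[OF bounded_linear_mult_left]
            C1_differentiable_on_imp_Ck_on[OF zeta_C1] subset_UNIV]])
  interpret smeared_level_sets Q K I \<epsilon> \<phi> \<eta>
  proof
    show "x \<in> K" if "t \<in> I" "x \<in> Q" "\<bar>\<phi> (x, t)\<bar> \<le> \<epsilon>" for x t
      using support_K that by blast
    show "grad (\<lambda>y. \<phi> (y, t)) x \<noteq> 0" if "t \<in> I" "x \<in> Q" "\<bar>\<phi> (x, t)\<bar> \<le> \<epsilon>" for x t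
      using grad_pos[OF that] by simp
    show "\<eta> s = 0" if "\<bar>s\<bar> > \<epsilon>" for s
      using zeta_support[of "s / \<epsilon>"] that eps by (auto simp: \<eta>_def field_simps abs_if split: if_splits)
  qed (use Q I smooth_phi K C1 in auto)
  \<comment> \<open>A match at regular points suffices: both integrands are 0 unless
    \<open>x \<in> Q\<close> and \<open>\<bar>\<phi> (x, s)\<bar> \<le> \<epsilon>\<close>, and such
    points are regular.\<close>
  have smeared: "smeared_integral Q \<epsilon> \<zeta> (\<lambda>x. \<phi> (x, s)) F = (LINT x|lborel. cut w (x, s))"
    if s: "s \<in> I" and w: "\<And>x. (x, s) \<in> regular \<Longrightarrow> w (x, s) = F x * slope (x, s)" for F w s
    unfolding smeared_integral_def set_lebesgue_integral_def
  proof (rule Bochner_Integration.integral_cong[OF refl])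
    fix x
    show "indicat_real Q x *\<^sub>R (if \<bar>\<phi> (x, s)\<bar> \<le> \<epsilon> then F x * norm (grad (\<lambda>x. \<phi> (x, s)) x) * (1 / \<epsilon>)
        * \<zeta> (\<phi> (x, s) / \<epsilon>) else 0) = cut w (x, s)"
    proof (cases "x \<in> Q \<and> \<bar>\<phi> (x, s)\<bar> \<le> \<epsilon>")
      case True
      then have "(x, s) \<in> regular" using regularI s by blast
      then show ?thesis
        unfolding cut_def using True w norm_grad_level by (simp add: \<eta>_def)
    qed (auto simp: cut_def)
  qed
  let ?f = "\<lambda>x. \<phi> (x, t)"
  let ?n = "normal_field ?f" and ?H = "mean_curv ?f" and ?G = "gauss_curv ?f"
  let ?R = "\<lambda>z. dderiv (0, 1) \<phi> z * (surf_laplace (\<lambda>z. deriv A (curv z)) z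
        + deriv A (curv z) * curv_sq z - A (curv z) * curv z)"
  have "?R (x, t) = (A (?H x) * ?H x - tlaplace ?n (\<lambda>y. deriv A (?H y)) x
      - deriv A (?H x) * ((?H x)\<^sup>2 - 2 * ?G x)) * (u (x, t) \<bullet> ?n x) * slope (x, t)"
    if xt: "(x, t) \<in> regular" for x
  proof -
    have "deriv (\<lambda>s. \<phi> (x, s)) t = dderiv (0, 1) \<phi> (x, t)"
      by (rule DERIV_imp_deriv[OF has_real_derivative_slice[OF diff_phi[OF t]]])
    moreover have "grad ?f x = slope (x, t) *\<^sub>R ?n x"
      using slope_pos[OF xt] by (simp add: normal_field_def norm_grad_level[OF xt])
    \<comment> \<open>The transport equation with the gradient written as \<open>slope\<close> times
      the normal. Its minus sign flips the signs in \<open>?R\<close> to those of the claimed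
      integrand.\<close>
    ultimately have \<psi>: "dderiv (0, 1) \<phi> (x, t) = - (slope (x, t) * (u (x, t) \<bullet> ?n x))"
      using transport[OF t, of x] by simp
    have "tlaplace ?n (\<lambda>y. deriv A (?H y)) x = surf_laplace (\<lambda>z. deriv A (curv z)) (x, t)"
      by (rule tlaplace_level[OF xt smooth_compose_curv[OF smooth_on_deriv[OF open_UNIV smooth_A]]])
        (simp add: mean_curv_level)
    moreover have "(?H x)\<^sup>2 - 2 * ?G x = curv_sq (x, t)"
      by (simp add: gauss_curv_eq curv_sq_level[OF xt])
    ultimately show ?thesis
      by (simp add: mean_curv_level[OF xt] \<psi> algebra_simps)
  qed
  from smeared[OF t this]
  have RHS: "smeared_integral Q \<epsilon> \<zeta> ?f (\<lambda>x. (A (?H x) * ?H x - tlaplace ?n (\<lambda>y. deriv A (?H y)) x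
      - deriv A (?H x) * ((?H x)\<^sup>2 - 2 * ?G x)) * (u (x, t) \<bullet> ?n x)) = (LINT x|lborel. cut ?R (x, t))" .
  have JH: "(LINT x|lborel. cut (\<lambda>z. A (curv z) * slope z) (x, s)) = JH Q \<epsilon> \<zeta> A \<phi> s" if "s \<in> I" for s
    unfolding JH_def by (rule smeared[OF that, symmetric]) (simp add: mean_curv_level)
  \<comment> \<open>The integral of the cut density is known to be \<open>JH\<close> for times in
    \<open>I\<close>; as \<open>I\<close> is an open neighbourhood of \<open>t\<close>, the
    derivative carries over.\<close>
  have "(JH Q \<epsilon> \<zeta> A \<phi> has_real_derivative (LINT x|lborel. cut ?R (x, t))) (at t)"
    by (rule has_field_derivative_transform_within_open[OF
          has_real_derivative_integral_cut[OF smooth_A t] I(1) t JH])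
  then show "let f = ?f; n = normal_field f; H = mean_curv f; G = gauss_curv f
     in (JH Q \<epsilon> \<zeta> A \<phi> has_real_derivative
          smeared_integral Q \<epsilon> \<zeta> f
            (\<lambda>x. (A (H x) * H x - tlaplace n (\<lambda>y. deriv A (H y)) x
                    - deriv A (H x) * ((H x)\<^sup>2 - 2 * G x))
                  * (u (x, t) \<bullet> n x))) (at t)"
    unfolding Let_def RHS .
qed

end
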